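(* Let $u$ be a Leray solution of the Navier-Stokes equations with initial datum $u_0$, and assume that $u\in C((0,T^* ),L^\infty)$ for some $T^*>0$. Let $\zeta\in\mathbb{N}^d$ (resp. $\zeta\in\mathbb{N}^3$) with $|\zeta|=k$, $\lambda\in(0,1)$ and $\delta\in(\frac{1}{1+\lambda},1)$. Then for any $t\in(0,T^* )$ the super-level sets $$S_{\zeta,\lambda}^{i,\pm}=\{x\in\mathbb{R}^d : (D^\zeta u)_i^\pm(x)>\lambda\|D^\zeta u\|_\infty\},\quad 1\le i\le d$$ $$\left(\text{resp. }S_{\zeta,\lambda}^{i,\pm}=\{x\in\mathbb{R}^3 : (D^\zeta\omega)_i^\pm(x)>\lambda\|D^\zeta\omega\|_\infty\},\quad 1\le i\le 3\right)$$ (taken at time $t$) are $d$-dimensional (resp. 3D) $\delta$-sparse around any spatial point $x_0$ at scale $$r^*=c(\|u_0\|_2)\frac{1}{\|D^\zeta u(t)\|_\infty^{2/(2k+d)}}\qquad\left(\text{resp. }r^*=c(\|u_0\|_2)\frac{1}{\|D^\zeta\omega(t)\|_\infty^{2/(2k+5)}}\right),$$ provided $r^*\in(0,1]$. In other words, $D^\zeta u(t)\in Z_\alpha(\lambda,\delta;c_0)$ with $\alpha=1/(k+d/2)$ (resp. $D^\zeta\omega(t)\in Z_\alpha(\lambda,\delta;c_0)$ with $\alpha=1/(k+5/2)$). Moreover, for any $p>2$, if $$u\in C((0,T^* ),L^\infty)\cap L^\infty((0,T^*],L^p),$$ then for any $t\in(0,T^* )$ the super-level sets $S_{\zeta,\lambda}^{i,\pm}$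 (of $D^\zeta u(t)$) are $d$-dimensional $\delta$-sparse around any spatial point $x_0$ at scale $$r^*=c\left(\sup_{t<T^*}\|u(t)\|_{L^p}\right)\frac{1}{\|D^\zeta u(t)\|_\infty^{1/(k+d/p)}},$$ provided $r^*\in(0,1]$, i.e. $D^\zeta u(t)\in Z_\alpha(\lambda,\delta;c_0)$ with $\alpha=1/(k+d/p)$.
   Context: The Navier-Stokes equations are $u_t-\Delta u+u\cdot\nabla u+\nabla p=0$, $\mathrm{div}\,u=0$ in $\mathbb{R}^d$ (viscosity $1$, zero external force), with $u(\cdot,0)=u_0$; the vorticity statements (given by "resp.") are in $\mathbb{R}^3$, with $\omega=\mathrm{curl}\,u$. A Leray solution is a global-in-time weak solution satisfying the global energy inequality. $c(\cdot)$ denotes a positive constant depending on the indicated norm (and on the fixed parameters $\zeta,\lambda,\delta,d,p$). $f_i^\pm$ are the positive and negative parts of the components of a vector field $f$, and for a vector $v=(a_1,\dots,a_d)$, $|v|=\max_i|a_i|$. An open set $S\subset\mathbb{R}^d$ is $d$-dimensional $\delta$-sparse around $x_0$ at scale $r$ if $\frac{|S\cap B_r(x_0)|}{|B_r(x_0)|}\le\delta$. Class $Z_\alpha(\lambda,\delta;c_0)$ ($\alpha>0$, $\lambda,\delta\in(0,1)$, $c_0>0$): bounded continuous $f:\mathbb{R}^d\to\mathbb{R}^d$ such that for every $x_0$, selecting a component with $f_i^\pm(x_0)=|f(x_0)|$, the set $\{x: f_i^\pm(x)>\lambda\|f\|_\infty\}$ is $d$-dimensional $\delta$-sparse around $x_0$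 at scale $c\,\|f\|_\infty^{-\alpha}$ for some $c$ comparable to $c_0$. *)

theory Defs
  imports "HOL-Analysis.Analysis" "HOL-Probability.Essential_Supremum"
begin

section \<open>Derivatives and test functions\<close>

definition dir_deriv ::
  "'a::euclidean_space \<Rightarrow> ('a \<Rightarrow> 'b::real_normed_vector) \<Rightarrow> 'a \<Rightarrow> 'b" where
  "dir_deriv v g x = frechet_derivative g (at x) v"

abbreviation partial ::
  "'d \<Rightarrow> (real^'d \<Rightarrow> 'b::real_normed_vector) \<Rightarrow> real^'d::finite \<Rightarrow> 'b" where
  "partial j \<equiv> dir_deriv (axis j 1)"

text \<open>All iterated partial derivatives exist and are differentiable, hence continuous;
  this is \<open>C\<^sup>\<infinity>\<close>.\<close>

definition smooth :: "('a::euclidean_space \<Rightarrow> 'b::real_normed_vector) \<Rightarrow> bool" where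
  "smooth g \<longleftrightarrow> (\<forall>bs. set bs \<subseteq> Basis \<longrightarrow> foldr dir_deriv bs g differentiable_on UNIV)"

definition test_function :: "('a::euclidean_space \<Rightarrow> 'b::real_normed_vector) \<Rightarrow> bool" where
  "test_function \<phi> \<longleftrightarrow> smooth \<phi> \<and> compact (closure {x. \<phi> x \<noteq> 0})"

text \<open>A multi-index is a function \<open>\<zeta> :: 'd \<Rightarrow> nat\<close> on the set of coordinates. The classical
  \<open>D\<^sup>\<zeta>\<close> is only applied to smooth functions, where the order of the differentiations
  does not matter; an arbitrary list containing each \<open>j\<close> exactly \<open>\<zeta> j\<close> times is used.\<close>

definition mi_order :: "('d::finite \<Rightarrow> nat) \<Rightarrow> nat" where
  "mi_order \<zeta> = (\<Sum>j\<in>UNIV. \<zeta> j)"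

definition mi_list :: "('d::finite \<Rightarrow> nat) \<Rightarrow> 'd list" where
  "mi_list \<zeta> = (SOME js. \<forall>j. count_list js j = \<zeta> j)"

definition mi_deriv ::
  "('d::finite \<Rightarrow> nat) \<Rightarrow> (real^'d \<Rightarrow> 'b::real_normed_vector) \<Rightarrow> real^'d \<Rightarrow> 'b" where
  "mi_deriv \<zeta> g = foldr partial (mi_list \<zeta>) g"

definition locally_integrable :: "(real^'d::finite \<Rightarrow> 'b::euclidean_space) \<Rightarrow> bool" where
  "locally_integrable f \<longleftrightarrow> (\<forall>K. compact K \<longrightarrow> set_integrable lebesgue K f)"

text \<open>\<open>weak_deriv \<zeta> v f\<close>: the distribution \<open>D\<^sup>\<zeta> v\<close> is (represented by) the function \<open>f\<close>.
  The function \<open>f\<close> is thereby determined up to a null set; no boundedness or continuity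
  of \<open>f\<close> is part of the definition.\<close>

definition weak_deriv ::
  "('d::finite \<Rightarrow> nat) \<Rightarrow> (real^'d \<Rightarrow> 'b::euclidean_space) \<Rightarrow> (real^'d \<Rightarrow> 'b) \<Rightarrow> bool" where
  "weak_deriv \<zeta> v f \<longleftrightarrow> locally_integrable v \<and> locally_integrable f \<and>
     (\<forall>\<phi> :: real^'d \<Rightarrow> real. test_function \<phi> \<longrightarrow>
        (\<integral>x. mi_deriv \<zeta> \<phi> x *\<^sub>R v x \<partial>lebesgue)
          = (-1) ^ mi_order \<zeta> *\<^sub>R (\<integral>x. \<phi> x *\<^sub>R f x \<partial>lebesgue))"

definition curl :: "(real^3 \<Rightarrow> real^3) \<Rightarrow> real^3 \<Rightarrow> real^3" where
  "curl g x = vector [partial 2 g x $ 3 - partial 3 g x $ 2,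
                      partial 3 g x $ 1 - partial 1 g x $ 3,
                      partial 1 g x $ 2 - partial 2 g x $ 1]"

text \<open>\<open>weak_curl v w\<close>: \<open>w = curl v\<close> in the sense of distributions.\<close>

definition weak_curl :: "(real^3 \<Rightarrow> real^3) \<Rightarrow> (real^3 \<Rightarrow> real^3) \<Rightarrow> bool" where
  "weak_curl v w \<longleftrightarrow> locally_integrable v \<and> locally_integrable w \<and>
     (\<forall>\<Phi>. test_function \<Phi> \<longrightarrow>
        (\<integral>x. w x \<bullet> \<Phi> x \<partial>lebesgue) = (\<integral>x. v x \<bullet> curl \<Phi> x \<partial>lebesgue))"


section \<open>Lebesgue norms\<close>

text \<open>The pointwise norm is Euclidean for finite \<open>p\<close> (as in the energy), while for \<open>p = \<infinity>\<close>
  it is \<open>|v| = max\<^sub>i |v\<^sub>i|\<close>, the library's \<^const>\<open>infnorm\<close>.\<close>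

definition in_Lp :: "real \<Rightarrow> (real^'d::finite \<Rightarrow> real^'d) \<Rightarrow> bool" where
  "in_Lp p f \<longleftrightarrow> f \<in> borel_measurable lebesgue \<and> integrable lebesgue (\<lambda>x. norm (f x) powr p)"

definition Lp_norm :: "real \<Rightarrow> (real^'d::finite \<Rightarrow> real^'d) \<Rightarrow> real" where
  "Lp_norm p f = (\<integral>x. norm (f x) powr p \<partial>lebesgue) powr (1 / p)"

definition Linf_norm :: "(real^'d::finite \<Rightarrow> real^'d) \<Rightarrow> ereal" where
  "Linf_norm f = esssup lebesgue (\<lambda>x. ereal (infnorm (f x)))"

definition in_Linf :: "(real^'d::finite \<Rightarrow> real^'d) \<Rightarrow> bool" where
  "in_Linf f \<longleftrightarrow> f \<in> borel_measurable lebesgue \<and> Linf_norm f < \<infinity>"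

text \<open>\<open>u \<in> C((0,T), L\<^sup>\<infinity>)\<close>\<close>

definition continuous_in_Linf ::
  "real \<Rightarrow> (real \<Rightarrow> real^'d::finite \<Rightarrow> real^'d) \<Rightarrow> bool" where
  "continuous_in_Linf T u \<longleftrightarrow>
     (\<forall>t\<in>{0<..<T}. in_Linf (u t) \<and>
        ((\<lambda>s. Linf_norm (\<lambda>x. u s x - u t x)) \<longlongrightarrow> 0) (at t))"

text \<open>\<open>u \<in> L\<^sup>\<infinity>((0,T], L\<^sup>p)\<close>, for fields that are jointly measurable in time and space.
  If also \<open>u \<in> C((0,T), L\<^sup>\<infinity>)\<close>, then by Fatou's lemma the bound holds for every \<open>t \<in> (0,T)\<close>,
  so that the supremum of \<open>Lp_norm p (u t)\<close> over \<open>(0,T)\<close> is finite.\<close>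

definition ess_bounded_in_Lp ::
  "real \<Rightarrow> real \<Rightarrow> (real \<Rightarrow> real^'d::finite \<Rightarrow> real^'d) \<Rightarrow> bool" where
  "ess_bounded_in_Lp p T u \<longleftrightarrow>
     (\<exists>M. AE t in lebesgue. 0 < t \<and> t \<le> T \<longrightarrow> in_Lp p (u t) \<and> Lp_norm p (u t) \<le> M)"


section \<open>Leray solutions\<close>

text \<open>Solenoidal test fields on \<open>[0,\<infinity>) \<times> \<real>\<^sup>d\<close> are taken as restrictions of
  solenoidal test fields on \<open>\<real> \<times> \<real>\<^sup>d\<close>; they need not vanish at time \<open>0\<close>.\<close>

definition solenoidal_test_field ::
  "(real \<times> (real^'d) \<Rightarrow> real^'d::finite) \<Rightarrow> bool" where
  "solenoidal_test_field \<Phi> \<longleftrightarrow> test_function \<Phi> \<and>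
     (\<forall>z. (\<Sum>j\<in>UNIV. dir_deriv (0, axis j 1) \<Phi> z $ j) = 0)"

definition weakly_solenoidal :: "(real^'d \<Rightarrow> real^'d::finite) \<Rightarrow> bool" where
  "weakly_solenoidal v \<longleftrightarrow>
     (\<forall>\<phi> :: real^'d \<Rightarrow> real. test_function \<phi> \<longrightarrow>
        (\<integral>x. (\<Sum>j\<in>UNIV. v x $ j * partial j \<phi> x) \<partial>lebesgue) = 0)"

text \<open>Global weak solutions of the Navier-Stokes equations
  \<open>u\<^sub>t - \<Delta>u + u \<cdot> \<nabla>u + \<nabla>p = 0\<close>, \<open>div u = 0\<close>, \<open>u(0) = u0\<close>, satisfying the global energy
  inequality. As usual, \<open>u\<close> is the representative that is weakly continuous into \<open>L\<^sup>2\<close>.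
  The pressure is eliminated by testing with solenoidal fields. The row \<open>G t x $ j\<close> is
  \<open>\<partial>\<^sub>j u(t,x)\<close>, so \<open>norm (G t x)\<close> is the Frobenius norm of \<open>\<nabla>u(t,x)\<close>; and
  \<open>dir_deriv (0, u t x) \<Phi> (t,x)\<close> is \<open>(u \<cdot> \<nabla>)\<Phi>\<close>.\<close>

definition leray_solution ::
  "(real^'d \<Rightarrow> real^'d) \<Rightarrow> (real \<Rightarrow> real^'d \<Rightarrow> real^'d::finite) \<Rightarrow> bool" where
  "leray_solution u0 u \<longleftrightarrow>
     in_Lp 2 u0 \<and> weakly_solenoidal u0 \<and> (AE x in lebesgue. u 0 x = u0 x) \<and>
     set_borel_measurable lebesgue ({0<..} \<times> UNIV) (\<lambda>(t, x). u t x) \<and>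
     (\<forall>t\<ge>0. in_Lp 2 (u t) \<and> weakly_solenoidal (u t)) \<and>
     (\<forall>w. in_Lp 2 w \<longrightarrow> continuous_on {0..} (\<lambda>t. \<integral>x. u t x \<bullet> w x \<partial>lebesgue)) \<and>
     (\<forall>\<Phi>. solenoidal_test_field \<Phi> \<longrightarrow>
        (LINT (t, x) : {0<..} \<times> UNIV | lebesgue.
           u t x \<bullet> (dir_deriv (1, 0) \<Phi> (t, x)
             + (\<Sum>j\<in>UNIV. dir_deriv (0, axis j 1) (dir_deriv (0, axis j 1) \<Phi>) (t, x))
             + dir_deriv (0, u t x) \<Phi> (t, x)))
        + (\<integral>x. u0 x \<bullet> \<Phi> (0, x) \<partial>lebesgue) = 0) \<and>
     (\<exists>G :: real \<Rightarrow> real^'d \<Rightarrow> real^'d^'d.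
        set_borel_measurable lebesgue ({0<..} \<times> UNIV) (\<lambda>(t, x). G t x) \<and>
        (AE t in lebesgue. 0 < t \<longrightarrow>
           (\<forall>j. weak_deriv (\<lambda>i. if i = j then 1 else 0) (u t) (\<lambda>x. G t x $ j))) \<and>
        set_integrable lebesgue ({0<..} \<times> UNIV) (\<lambda>(t, x). (norm (G t x))\<^sup>2) \<and>
        (\<forall>t\<ge>0. (\<integral>x. (norm (u t x))\<^sup>2 \<partial>lebesgue)
           + 2 * (LINT (s, x) : {0<..<t} \<times> UNIV | lebesgue. (norm (G s x))\<^sup>2)
           \<le> (\<integral>x. (norm (u0 x))\<^sup>2 \<partial>lebesgue)))"


section \<open>Sparseness\<close>

definition sparse_around :: "real \<Rightarrow> real \<Rightarrow> (real^'d::finite) set \<Rightarrow> real^'d \<Rightarrow> bool" where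
  "sparse_around \<delta> r S x0 \<longleftrightarrow>
     measure lebesgue (S \<inter> ball x0 r) / measure lebesgue (ball x0 r) \<le> \<delta>"

text \<open>\<open>f\<^sub>i\<^sup>+\<close> for \<open>\<sigma> = 1\<close> and \<open>f\<^sub>i\<^sup>-\<close> for \<open>\<sigma> = -1\<close>.\<close>

definition comp_part ::
  "real \<Rightarrow> 'd \<Rightarrow> (real^'d \<Rightarrow> real^'d) \<Rightarrow> real^'d::finite \<Rightarrow> real" where
  "comp_part \<sigma> i f x = max (\<sigma> * f x $ i) 0"

definition super_level ::
  "real \<Rightarrow> real \<Rightarrow> 'd \<Rightarrow> (real^'d \<Rightarrow> real^'d) \<Rightarrow> (real^'d::finite) set" where
  "super_level lam \<sigma> i f = {x. ereal (comp_part \<sigma> i f x) > ereal lam * Linf_norm f}"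

text \<open>\<open>K\<close> is the factor up to which the constant \<open>c\<close> is comparable to \<open>c0\<close>.\<close>

definition Z_class ::
  "real \<Rightarrow> real \<Rightarrow> real \<Rightarrow> real \<Rightarrow> real \<Rightarrow> (real^'d::finite \<Rightarrow> real^'d) set" where
  "Z_class K \<alpha> lam \<delta> c0 =
     {f. continuous_on UNIV f \<and> bounded (range f) \<and>
        (\<forall>x0 i. \<forall>\<sigma>\<in>{1, -1}. comp_part \<sigma> i f x0 = infnorm (f x0) \<longrightarrow>
           (\<exists>c. c0 / K \<le> c \<and> c \<le> K * c0 \<and>
              sparse_around \<delta> (c * real_of_ereal (Linf_norm f) powr (- \<alpha>))
                (super_level lam \<sigma> i f) x0))}"

text \<open>\<open>sparse_scale c \<beta> f\<close> is \<open>c / \<parallel>f\<parallel>\<^sub>\<infinity>\<^sup>\<beta>\<close>. It takes the value \<open>0\<close>, which is never in \<open>(0,1]\<close>, both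
  if \<open>\<parallel>f\<parallel>\<^sub>\<infinity> = \<infinity>\<close> and if \<open>\<parallel>f\<parallel>\<^sub>\<infinity> = 0\<close> (where the quotient is mathematically \<open>\<infinity>\<close>).\<close>

definition sparse_scale :: "real \<Rightarrow> real \<Rightarrow> (real^'d::finite \<Rightarrow> real^'d) \<Rightarrow> real" where
  "sparse_scale c \<beta> f = c * (1 / real_of_ereal (Linf_norm f) powr \<beta>)"

end

(*
  If the super-level set of f_i filled more than the fraction delta > 1/(1+lam) of a ball B of radius r,
  then the average of f_i over B would be at least a positive multiple of F = ||f||_inf: the
  super-level part contributes lam F, and the remaining fraction of B costs at most F. This survives
  replacing the indicator of B by a smooth bump phi supported in B. But f is a derivative of order m of
  v (m = k for D^zeta u, m = k + 1 for D^zeta curl u), so moving the derivatives onto phi bounds the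
  integral of phi f_i by C r^(-m) times the integral of |v| over B, and hence by
  C' r^(-m) ||v||_p |B|^(1-1/p). Thus F r^(m+d/p) is bounded in terms of ||v||_p, which is false for
  r = c F^(-1/(m+d/p)) with c large. The norm of v = u(t) is controlled by the energy inequality if
  p = 2, and by Fatou's lemma along times s -> t otherwise.
*)

theory Submission
  imports Defs
begin

section \<open>A smooth bump function\<close>

text \<open>An indicator is not an admissible test function, and smoothing it loses mass near the
  sphere. The hypothesis \<delta> > 1 / (1 + lam) says exactly that lam * \<delta> > 1 - \<delta>,
  which leaves a fixed positive margin; the bump is taken so close to the indicator that its loss
  stays below this margin. It therefore depends on lam, \<delta> and the dimension alone, is fixed
  before any solution enters, and is afterwards only translated and dilated. Its derivatives of
  order m then scale like r^(-m), with a constant that serves all balls and all solutions. The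
  exponent is forced by scaling: dividing the upper bound by |B| leaves r^(-m) |B|^(-1/p), of order
  r^(-(m + d/p)). For p = 2 and m = k this gives 1 / (k + d/2) = 2 / (2k + d); for the vorticity m =
  k + 1 and d = 3 give 1 / (k + 5/2). A weak derivative is known only almost everywhere, so
  sparseness is obtained by comparing integrals, never from values of f at single points.\<close>

lemma dir_deriv_eq:
  assumes "(g has_derivative g') (at x)"
  shows "dir_deriv v g x = g' v"
  unfolding dir_deriv_def using frechet_derivative_at[OF assms] by simp

text \<open>All derivatives of \<open>x \<mapsto> exp (- 1 / x)\<close> (extended by \<open>0\<close> to \<open>x \<le> 0\<close>) are of this form.\<close>

definition exp_poly :: "real poly \<Rightarrow> real \<Rightarrow> real" where
  "exp_poly p x = (if 0 < x then poly p (1 / x) * exp (- (1 / x)) else 0)"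

lemma poly_times_exp_neg_tendsto_0: "((\<lambda>y. poly p y * exp (- y)) \<longlongrightarrow> (0::real)) at_top"
proof -
  have "((\<lambda>y. \<Sum>i\<le>degree p. coeff p i * (y ^ i / exp y)) \<longlongrightarrow> (\<Sum>i\<le>degree p. coeff p i * 0)) at_top"
    by (intro tendsto_sum tendsto_mult tendsto_const tendsto_power_div_exp_0)
  moreover have "(\<Sum>i\<le>degree p. coeff p i * (y ^ i / exp y)) = poly p y * exp (- y)" for y
    by (simp add: poly_altdef exp_minus sum_distrib_right divide_inverse mult.assoc)
  ultimately show ?thesis by simp
qed

text \<open>With y = 1 / x, differentiating p(y) exp(-y) in x gives y^2 (p(y) - p'(y)) exp(-y),
  which is again a polynomial in y times exp(-y). At 0 all these functions are flat because the
  exponential beats every polynomial.\<close>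

lemma exp_poly_has_derivative:
  "(exp_poly p has_real_derivative exp_poly (monom 1 2 * (p - pderiv p)) x) (at x)"
proof -
  consider "x > 0" | "x < 0" | "x = 0" by linarith
  then show ?thesis
  proof cases
    case 1
    have "((\<lambda>x. poly p (1 / x) * exp (- (1 / x))) has_real_derivative
        exp_poly (monom 1 2 * (p - pderiv p)) x) (at x)"
      using 1 unfolding exp_poly_def
      by (auto intro!: derivative_eq_intros DERIV_chain'[OF _ poly_DERIV]
          simp: poly_monom field_simps power2_eq_square)
    moreover have "eventually (\<lambda>y. 0 < y) (nhds x)"
      using 1 by (rule eventually_nhds_in_open[of "{0<..}" x, simplified])
    ultimately show ?thesis
      by (subst DERIV_cong_ev[OF refl _ refl]) (auto simp: exp_poly_def elim!: eventually_mono)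
  next
    case 2
    have "((\<lambda>x::real. 0::real) has_real_derivative 0) (at x)" by simp
    then have "(exp_poly p has_real_derivative 0) (at x)"
      by (rule has_field_derivative_transform_within_open[where S="{..<0}"])
        (use 2 in \<open>auto simp: exp_poly_def\<close>)
    then show ?thesis using 2 by (simp add: exp_poly_def)
  next
    case 3
    \<comment> \<open>Dividing by h multiplies the polynomial by its variable, so the difference
      quotient of \<open>exp_poly p\<close> at 0 is \<open>exp_poly (pCons 0 p)\<close>.\<close>
    have "((\<lambda>x. exp_poly (pCons 0 p) x) \<longlongrightarrow> 0) (at_right 0)"
    proof -
      have "((\<lambda>x. poly (pCons 0 p) (inverse x) * exp (- (inverse x))) \<longlongrightarrow> (0::real)) (at_right 0)"
        by (rule filterlim_compose[OF poly_times_exp_neg_tendsto_0 filterlim_inverse_at_top_right])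
      moreover have "eventually (\<lambda>x. poly (pCons 0 p) (inverse x) * exp (- (inverse x))
          = exp_poly (pCons 0 p) x) (at_right 0)"
        by (auto simp: exp_poly_def inverse_eq_divide eventually_at_filter)
      ultimately show ?thesis
        by (rule Lim_transform_eventually)
    qed
    moreover have "((\<lambda>x. exp_poly (pCons 0 p) x) \<longlongrightarrow> 0) (at_left 0)"
      by (rule Lim_transform_eventually[of "\<lambda>x. 0"])
         (auto simp: exp_poly_def eventually_at_filter)
    ultimately have "((\<lambda>x. exp_poly (pCons 0 p) x) \<longlongrightarrow> 0) (at 0)"
      by (simp add: filterlim_split_at)
    moreover have "exp_poly (pCons 0 p) h = (exp_poly p (0 + h) - exp_poly p 0) / h" for h
      by (simp add: exp_poly_def)
    ultimately show ?thesis using 3 by (simp add: DERIV_def exp_poly_def)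
  qed
qed

text \<open>An invariant argument: iterated derivatives never leave \<open>A\<close>, so no formula
  for the derivatives of a given order is required.\<close>

lemma smooth_if_closed_family:
  fixes A :: "('a::euclidean_space \<Rightarrow> 'b::real_normed_vector) set"
  assumes "f \<in> A" and "\<And>g. g \<in> A \<Longrightarrow> g differentiable_on UNIV"
    and "\<And>g b. g \<in> A \<Longrightarrow> b \<in> Basis \<Longrightarrow> dir_deriv b g \<in> A"
  shows "smooth f"
proof -
  have "foldr dir_deriv bs f \<in> A" if "set bs \<subseteq> Basis" for bs
    using that by (induction bs) (auto intro: assms)
  then show ?thesis unfolding smooth_def using assms(2) by blast
qed

text \<open>The derivative of a radial bump is another such bump times a linear function. Closing
  the bumps, the constants and the linear forms under sums and products gives a family that is
  stable under every directional derivative.\<close>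

inductive_set bump_algebra :: "real \<Rightarrow> ('a::euclidean_space \<Rightarrow> real) set" for c where
  const: "(\<lambda>x. a) \<in> bump_algebra c"
| linear: "(\<lambda>x. x \<bullet> b) \<in> bump_algebra c"
| bump: "(\<lambda>x. exp_poly p (c * (1 - x \<bullet> x))) \<in> bump_algebra c"
| add: "f \<in> bump_algebra c \<Longrightarrow> g \<in> bump_algebra c \<Longrightarrow> (\<lambda>x. f x + g x) \<in> bump_algebra c"
| mult: "f \<in> bump_algebra c \<Longrightarrow> g \<in> bump_algebra c \<Longrightarrow> (\<lambda>x. f x * g x) \<in> bump_algebra c"

lemma bump_algebra_derivative:
  assumes "f \<in> bump_algebra c"
  shows "(\<forall>x. f differentiable at x) \<and> dir_deriv v f \<in> bump_algebra c"
  using assms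
proof induction
  case (const a)
  have "dir_deriv v (\<lambda>x. a) = (\<lambda>x. 0)"
    by (rule ext, rule dir_deriv_eq[where g'="\<lambda>x. 0"]) simp
  then show ?case by (auto intro: bump_algebra.const)
next
  case (linear b)
  have D: "((\<lambda>x. x \<bullet> b) has_derivative (\<lambda>h. h \<bullet> b)) (at x)" for x
    by (auto intro!: derivative_eq_intros)
  have "dir_deriv v (\<lambda>x. x \<bullet> b) = (\<lambda>x. v \<bullet> b)"
    by (rule ext, rule dir_deriv_eq[OF D])
  then show ?case using D by (auto intro: bump_algebra.const differentiableI)
next
  case (bump p)
  let ?q = "monom 1 2 * (p - pderiv p)"
  have D: "((\<lambda>x. exp_poly p (c * (1 - x \<bullet> x))) has_derivative
      (\<lambda>h. exp_poly ?q (c * (1 - x \<bullet> x)) * (- 2 * c * (x \<bullet> h)))) (at x)" for x :: 'a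
  proof -
    have "((\<lambda>x. c * (1 - x \<bullet> x)) has_derivative (\<lambda>h. - 2 * c * (x \<bullet> h))) (at x)"
      by (auto intro!: derivative_eq_intros simp: inner_commute algebra_simps)
    from has_derivative_compose[OF this exp_poly_has_derivative[unfolded has_field_derivative_def]]
    show ?thesis by simp
  qed
  have "dir_deriv v (\<lambda>x. exp_poly p (c * (1 - x \<bullet> x))) =
      (\<lambda>x. exp_poly ?q (c * (1 - x \<bullet> x)) * (- 2 * c * (x \<bullet> v)))"
    by (rule ext, rule dir_deriv_eq[OF D])
  moreover have "(\<lambda>x::'a. exp_poly ?q (c * (1 - x \<bullet> x)) * (- 2 * c * (x \<bullet> v))) \<in> bump_algebra c"
    by (intro bump_algebra.intros)
  ultimately show ?case using D by (auto intro: differentiableI)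
next
  case (add f g)
  have D: "((\<lambda>x. f x + g x) has_derivative
     (\<lambda>h. frechet_derivative f (at x) h + frechet_derivative g (at x) h)) (at x)" for x
    using add.IH by (intro has_derivative_add) (auto simp: frechet_derivative_works[symmetric])
  have "dir_deriv v (\<lambda>x. f x + g x) = (\<lambda>x. dir_deriv v f x + dir_deriv v g x)"
    by (rule ext, unfold dir_deriv_def[of v f] dir_deriv_def[of v g], rule dir_deriv_eq[OF D])
  then show ?case using D add.IH by (auto intro: bump_algebra.add differentiableI)
next
  case (mult f g)
  have D: "((\<lambda>x. f x * g x) has_derivative
     (\<lambda>h. f x * frechet_derivative g (at x) h + frechet_derivative f (at x) h * g x)) (at x)" for x
    using mult.IH by (intro has_derivative_mult) (auto simp: frechet_derivative_works[symmetric])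
  have "dir_deriv v (\<lambda>x. f x * g x) = (\<lambda>x. f x * dir_deriv v g x + dir_deriv v f x * g x)"
    by (rule ext, unfold dir_deriv_def[of v f] dir_deriv_def[of v g], rule dir_deriv_eq[OF D])
  then show ?case
    using D mult by (auto intro!: bump_algebra.add bump_algebra.mult differentiableI)
qed

lemma smooth_bump_algebra: "f \<in> bump_algebra c \<Longrightarrow> smooth f"
  by (rule smooth_if_closed_family[of _ "bump_algebra c"])
     (auto simp: bump_algebra_derivative differentiable_on_def differentiable_at_imp_differentiable_on)

text \<open>The profile exp (- 1 / (c (1 - |x|^2))) vanishes outside the unit ball for every c > 0
  and tends to 1 inside as c grows, so one parameter suffices to approach the indicator.\<close>

lemma bump_function_exists:
  fixes \<eta> \<rho> :: real
  assumes "0 < \<eta>" and "0 < \<rho>" "\<rho> < 1"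
  obtains \<phi> :: "'a::euclidean_space \<Rightarrow> real" where
    "smooth \<phi>" "\<And>x. 0 \<le> \<phi> x" "\<And>x. \<phi> x \<le> 1" "\<And>x. 1 \<le> norm x \<Longrightarrow> \<phi> x = 0"
    "\<And>x. norm x \<le> \<rho> \<Longrightarrow> 1 - \<eta> \<le> \<phi> x"
proof
  \<comment> \<open>This makes 1 / (c (1 - |x|^2)) equal to \<eta> on the sphere of radius \<rho>
    and smaller inside; exp (- y) \<ge> 1 - y does the rest.\<close>
  define c where "c = 1 / (\<eta> * (1 - \<rho>\<^sup>2))"
  define \<phi> :: "'a \<Rightarrow> real" where "\<phi> = (\<lambda>x. exp_poly 1 (c * (1 - x \<bullet> x)))"
  have \<rho>: "\<rho>\<^sup>2 < 1" using assms by (simp add: power_less_one_iff)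
  then have c: "0 < c" using assms by (simp add: c_def)
  show "smooth \<phi>" unfolding \<phi>_def by (rule smooth_bump_algebra) (rule bump_algebra.bump)
  show "0 \<le> \<phi> x" "\<phi> x \<le> 1" for x by (auto simp: \<phi>_def exp_poly_def)
  show "\<phi> x = 0" if "1 \<le> norm x" for x
  proof -
    have "1 \<le> x \<bullet> x" using that by (simp add: norm_eq_sqrt_inner)
    then have "c * (1 - x \<bullet> x) \<le> 0" using c by (simp add: mult_le_0_iff)
    then show ?thesis by (simp add: \<phi>_def exp_poly_def)
  qed
  show "1 - \<eta> \<le> \<phi> x" if "norm x \<le> \<rho>" for x
  proof -
    have "x \<bullet> x \<le> \<rho>\<^sup>2" using power_mono[OF that, of 2] by (simp add: power2_norm_eq_inner)
    then have "c * (1 - \<rho>\<^sup>2) \<le> c * (1 - x \<bullet> x)" using c by simp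
    moreover have "c * (1 - \<rho>\<^sup>2) = 1 / \<eta>" using \<rho> assms by (simp add: c_def)
    ultimately have *: "1 / \<eta> \<le> c * (1 - x \<bullet> x)" by simp
    moreover have "0 < 1 / \<eta>" using assms by simp
    ultimately have pos: "0 < c * (1 - x \<bullet> x)" by linarith
    then have "1 / (c * (1 - x \<bullet> x)) \<le> \<eta>" using * assms by (simp add: field_simps)
    moreover have "1 + - (1 / (c * (1 - x \<bullet> x))) \<le> exp (- (1 / (c * (1 - x \<bullet> x))))"
      by (rule exp_ge_add_one_self)
    ultimately show ?thesis using pos by (simp add: \<phi>_def exp_poly_def)
  qed
qed

section \<open>Iterated derivatives\<close>

lemma smooth_differentiable:
  "smooth g \<Longrightarrow> set bs \<subseteq> Basis \<Longrightarrow> foldr dir_deriv bs g differentiable at x"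
  by (auto simp: smooth_def differentiable_on_def)

lemma smooth_foldr_dir_deriv: "smooth g \<Longrightarrow> set bs \<subseteq> Basis \<Longrightarrow> smooth (foldr dir_deriv bs g)"
  unfolding smooth_def
proof (intro allI impI)
  fix bs' :: "'a list"
  assume "\<forall>bs. set bs \<subseteq> Basis \<longrightarrow> foldr dir_deriv bs g differentiable_on UNIV"
    and "set bs \<subseteq> Basis" "set bs' \<subseteq> Basis"
  then have "foldr dir_deriv (bs' @ bs) g differentiable_on UNIV" by (simp del: foldr_append)
  then show "foldr dir_deriv bs' (foldr dir_deriv bs g) differentiable_on UNIV" by simp
qed

lemma smooth_continuous: "smooth g \<Longrightarrow> continuous_on UNIV g"
  using differentiable_imp_continuous_on[of g UNIV] by (auto simp: smooth_def dest: spec[of _ "[]"])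

lemma foldr_dir_deriv_rescale:
  fixes g :: "'a::euclidean_space \<Rightarrow> 'b::real_normed_vector"
  assumes "smooth g" "set bs \<subseteq> Basis"
  shows "foldr dir_deriv bs (\<lambda>x. g (s *\<^sub>R (x - x0)))
    = (\<lambda>x. s ^ length bs *\<^sub>R foldr dir_deriv bs g (s *\<^sub>R (x - x0)))"
  using assms(2)
proof (induction bs)
  case (Cons b bs)
  let ?h = "foldr dir_deriv bs g"
  have "((\<lambda>x. s ^ length bs *\<^sub>R ?h (s *\<^sub>R (x - x0))) has_derivative
      (\<lambda>v. s ^ length bs *\<^sub>R frechet_derivative ?h (at (s *\<^sub>R (x - x0))) (s *\<^sub>R v))) (at x)" for x
  proof -
    have "(?h has_derivative frechet_derivative ?h (at (s *\<^sub>R (x - x0)))) (at (s *\<^sub>R (x - x0)))"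
      using smooth_differentiable[OF assms(1)] Cons.prems by (simp add: frechet_derivative_works[symmetric])
    moreover have "((\<lambda>x. s *\<^sub>R (x - x0)) has_derivative (\<lambda>v. s *\<^sub>R v)) (at x)"
      by (auto intro!: derivative_eq_intros simp: algebra_simps)
    ultimately show ?thesis
      by (intro has_derivative_scaleR_right) (rule has_derivative_compose)
  qed
  from dir_deriv_eq[OF this]
  have "dir_deriv b (\<lambda>x. s ^ length bs *\<^sub>R ?h (s *\<^sub>R (x - x0))) x
      = s ^ length bs *\<^sub>R frechet_derivative ?h (at (s *\<^sub>R (x - x0))) (s *\<^sub>R b)" for x .
  moreover have "frechet_derivative ?h (at y) (s *\<^sub>R b) = s *\<^sub>R dir_deriv b ?h y" for y
    using smooth_differentiable[OF assms(1)] Cons.prems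
    by (simp add: dir_deriv_def linear_frechet_derivative linear_scale)
  ultimately show ?case using Cons.IH Cons.prems by (auto simp: mult.commute)
qed simp

lemma smooth_rescale:
  fixes g :: "'a::euclidean_space \<Rightarrow> 'b::real_normed_vector"
  assumes "smooth g"
  shows "smooth (\<lambda>x. g (s *\<^sub>R (x - x0)))"
  unfolding smooth_def
proof (intro allI impI)
  fix bs :: "'a list" assume bs: "set bs \<subseteq> Basis"
  have "(\<lambda>x. s ^ length bs *\<^sub>R foldr dir_deriv bs g (s *\<^sub>R (x - x0))) differentiable at x" for x
  proof -
    have "(\<lambda>x. s *\<^sub>R (x - x0)) differentiable at x"
      by (intro derivative_intros)
    then have "(\<lambda>x. foldr dir_deriv bs g (s *\<^sub>R (x - x0))) differentiable at x"
      by (rule differentiable_compose[OF smooth_differentiable[OF assms bs]])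
    then show ?thesis by (intro differentiable_scaleR) auto
  qed
  then show "foldr dir_deriv bs (\<lambda>x. g (s *\<^sub>R (x - x0))) differentiable_on UNIV"
    unfolding foldr_dir_deriv_rescale[OF assms bs] by (simp add: differentiable_on_def)
qed

text \<open>Used for the test fields \<psi> e_i, which reduce the vector identity for the weak curl
  to scalar bumps.\<close>

lemma foldr_dir_deriv_scaleR_const:
  fixes g :: "'a::euclidean_space \<Rightarrow> real" and e :: "'b::real_normed_vector"
  assumes "smooth g" "set bs \<subseteq> Basis"
  shows "foldr dir_deriv bs (\<lambda>x. g x *\<^sub>R e) = (\<lambda>x. foldr dir_deriv bs g x *\<^sub>R e)"
  using assms(2)
proof (induction bs)
  case (Cons b bs)
  have "((\<lambda>x. foldr dir_deriv bs g x *\<^sub>R e) has_derivative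
      (\<lambda>v. frechet_derivative (foldr dir_deriv bs g) (at x) v *\<^sub>R e)) (at x)" for x
    using smooth_differentiable[OF assms(1)] Cons.prems
    by (intro has_derivative_scaleR_left) (simp add: frechet_derivative_works[symmetric])
  from dir_deriv_eq[OF this]
  have "dir_deriv b (\<lambda>x. foldr dir_deriv bs g x *\<^sub>R e) x = dir_deriv b (foldr dir_deriv bs g) x *\<^sub>R e" for x
    by (simp only: dir_deriv_def[of _ "foldr dir_deriv bs g"])
  then show ?case using Cons.IH Cons.prems by auto
qed simp

lemma smooth_scaleR_const:
  fixes g :: "'a::euclidean_space \<Rightarrow> real" and e :: "'b::real_normed_vector"
  assumes "smooth g"
  shows "smooth (\<lambda>x. g x *\<^sub>R e)"
  unfolding smooth_def
proof (intro allI impI)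
  fix bs :: "'a list" assume bs: "set bs \<subseteq> Basis"
  show "foldr dir_deriv bs (\<lambda>x. g x *\<^sub>R e) differentiable_on UNIV"
    unfolding foldr_dir_deriv_scaleR_const[OF assms bs] differentiable_on_def
    using smooth_differentiable[OF assms bs] by (auto intro!: differentiable_scaleR)
qed

lemma foldr_dir_deriv_eq_0_on_open:
  fixes g :: "'a::euclidean_space \<Rightarrow> 'b::real_normed_vector"
  assumes "open U" "\<And>x. x \<in> U \<Longrightarrow> g x = 0" "x \<in> U"
  shows "foldr dir_deriv bs g x = 0"
  using assms(3)
proof (induction bs arbitrary: x)
  case (Cons b bs)
  have "(foldr dir_deriv bs g has_derivative (\<lambda>v. 0)) (at x)"
    by (rule has_derivative_transform_within_open[OF has_derivative_const[of 0] assms(1) Cons.prems])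
       (simp add: Cons.IH)
  from dir_deriv_eq[OF this] show ?case by simp
qed (simp add: assms(2))

lemma test_function_if_eq_0_outside:
  assumes "smooth \<phi>" "compact K" "\<And>x. x \<notin> K \<Longrightarrow> \<phi> x = 0"
  shows "test_function \<phi>"
proof -
  have "closure {x. \<phi> x \<noteq> 0} \<subseteq> K"
    using assms by (intro closure_minimal) (auto simp: compact_imp_closed)
  then have "compact (closure {x. \<phi> x \<noteq> 0})"
    using compact_Int_closed[OF assms(2), of "closure {x. \<phi> x \<noteq> 0}"] by (simp add: Int_absorb1)
  then show ?thesis using assms(1) by (simp add: test_function_def)
qed

text \<open>Each differentiation of the dilated bump costs a factor 1 / r, and \<open>C\<close> is
  the maximum of the undilated derivative on the closed unit ball, hence the same for all centres
  and radii. The closed ball appears because locality of the derivative gives vanishing only on the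
  open exterior; the sphere is covered by the maximum.\<close>

lemma rescaled_derivative_bound:
  fixes \<phi> :: "'a::euclidean_space \<Rightarrow> real"
  assumes \<phi>: "smooth \<phi>" "\<And>x. 1 \<le> norm x \<Longrightarrow> \<phi> x = 0" and bs: "set bs \<subseteq> Basis"
  obtains C where "0 \<le> C"
    "\<And>x0 r x. 0 < r \<Longrightarrow> \<bar>foldr dir_deriv bs (\<lambda>x. \<phi> ((1 / r) *\<^sub>R (x - x0))) x\<bar>
       \<le> C / r ^ length bs * indicator (cball x0 r) x"
proof -
  let ?D = "foldr dir_deriv bs \<phi>"
  have "continuous_on (cball 0 1) ?D"
    using smooth_continuous[OF smooth_foldr_dir_deriv[OF \<phi>(1) bs]] continuous_on_subset by blast
  then have "bounded (?D ` cball 0 1)"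
    by (intro compact_imp_bounded compact_continuous_image compact_cball)
  then obtain C where C: "0 < C" "\<And>x. x \<in> cball 0 1 \<Longrightarrow> \<bar>?D x\<bar> \<le> C"
    by (auto simp: bounded_pos)
  have zero: "?D x = 0" if "1 < norm x" for x
  proof (rule foldr_dir_deriv_eq_0_on_open[of "- cball 0 1"])
    show "open (- cball (0::'a) 1)" by (intro open_Compl closed_cball)
  qed (use that \<phi>(2) in auto)
  show ?thesis
  proof
    show "0 \<le> C" using C by simp
    fix x0 x :: 'a and r :: real assume r: "0 < r"
    have n: "norm ((1 / r) *\<^sub>R (x - x0)) = dist x0 x / r"
      using r by (simp add: dist_norm norm_minus_commute)
    have eq: "foldr dir_deriv bs (\<lambda>x. \<phi> ((1 / r) *\<^sub>R (x - x0))) x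
        = ?D ((1 / r) *\<^sub>R (x - x0)) / r ^ length bs"
      by (simp add: foldr_dir_deriv_rescale[OF \<phi>(1) bs] power_one_over divide_inverse power_inverse)
    show "\<bar>foldr dir_deriv bs (\<lambda>x. \<phi> ((1 / r) *\<^sub>R (x - x0))) x\<bar>
       \<le> C / r ^ length bs * indicator (cball x0 r) x"
    proof (cases "x \<in> cball x0 r")
      case True
      then have "norm ((1 / r) *\<^sub>R (x - x0)) \<le> 1" unfolding n using r by simp
      then have "\<bar>?D ((1 / r) *\<^sub>R (x - x0))\<bar> \<le> C" by (intro C) simp
      then show ?thesis unfolding eq using True r by (simp add: abs_divide divide_right_mono)
    next
      case False
      then have "1 < norm ((1 / r) *\<^sub>R (x - x0))" unfolding n using r by simp
      then show ?thesis unfolding eq using zero False by simp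
    qed
  qed
qed

section \<open>Multi-indices as lists of coordinate directions\<close>

lemma count_list_mi_list: "count_list (mi_list \<zeta>) j = \<zeta> j"
proof -
  have "\<exists>js. \<forall>j. count_list js j = (if j \<in> A then \<zeta> j else 0)" if "finite A" for A :: "'a set"
    using that
  proof induction
    case empty
    show ?case by (auto intro: exI[of _ "[]"])
  next
    case (insert a A)
    then obtain js where "\<forall>j. count_list js j = (if j \<in> A then \<zeta> j else 0)" by blast
    moreover have "count_list (replicate n a) j = (if j = a then n else 0)" for n j
      by (induction n) auto
    ultimately show ?case using insert.hyps
      by (intro exI[of _ "replicate (\<zeta> a) a @ js"]) auto
  qed
  from this[OF finite[of UNIV]] have "\<exists>js. \<forall>j. count_list js j = \<zeta> j" by simp
  from someI_ex[OF this] show ?thesis by (simp add: mi_list_def)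
qed

lemma length_mi_list: "length (mi_list \<zeta>) = mi_order \<zeta>"
proof -
  have "(\<Sum>j\<in>UNIV. count_list (mi_list \<zeta>) j) = length (mi_list \<zeta>)"
    using sum_count_set[of "mi_list \<zeta>" UNIV] by simp
  then show ?thesis by (simp add: count_list_mi_list mi_order_def)
qed

text \<open>Brings \<open>mi_deriv\<close> into the form \<open>foldr dir_deriv bs\<close>, for
  which smoothness and rescaling are established.\<close>

definition mi_dirs :: "('d::finite \<Rightarrow> nat) \<Rightarrow> (real^'d) list" where
  "mi_dirs \<zeta> = map (\<lambda>j. axis j 1) (mi_list \<zeta>)"

lemma mi_dirs: "set (mi_dirs \<zeta>) \<subseteq> Basis" "length (mi_dirs \<zeta>) = mi_order \<zeta>"
  by (auto simp: mi_dirs_def length_mi_list)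

lemma mi_deriv_eq: "mi_deriv \<zeta> g = foldr dir_deriv (mi_dirs \<zeta>) g"
  by (simp add: mi_deriv_def mi_dirs_def foldr_map o_def)

section \<open>Averages of weak derivatives\<close>

lemma locally_integrable_norm:
  "locally_integrable w \<Longrightarrow> compact K \<Longrightarrow> set_integrable lebesgue K (\<lambda>x. norm (w x))"
  unfolding locally_integrable_def by (blast intro: set_integrable_norm)

lemma locally_integrable_borel_measurable:
  fixes w :: "real^'d::finite \<Rightarrow> 'b::euclidean_space"
  assumes "locally_integrable w"
  shows "w \<in> borel_measurable lebesgue"
proof (rule borel_measurable_LIMSEQ_metric)
  fix n :: nat
  have "set_integrable lebesgue (cball 0 (real n)) w"
    using assms by (simp add: locally_integrable_def)
  then show "(\<lambda>x. indicator (cball 0 (real n)) x *\<^sub>R w x) \<in> borel_measurable lebesgue"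
    unfolding set_integrable_def by (rule borel_measurable_integrable)
next
  fix x :: "real^'d"
  obtain m :: nat where m: "norm x \<le> real m" using real_arch_simple by blast
  have "eventually (\<lambda>n. w x = indicator (cball 0 (real n)) x *\<^sub>R w x) sequentially"
    using eventually_ge_at_top[of m] by eventually_elim (use m in \<open>auto simp: indicator_def\<close>)
  then show "(\<lambda>n. indicator (cball 0 (real n)) x *\<^sub>R w x) \<longlonglongrightarrow> w x"
    by (rule Lim_transform_eventually[OF tendsto_const])
qed

text \<open>If \<open>F\<close> is not integrable, its integral is 0 by convention and the bound is
  trivial; so integrability is established only for the dominating function.\<close>

lemma norm_integral_le_locally_integrable:
  fixes w :: "real^'d::finite \<Rightarrow> 'b::euclidean_space" and F :: "real^'d \<Rightarrow> 'c::{banach, second_countable_topology}"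
  assumes "locally_integrable w" "compact K" "0 \<le> C"
    and "\<And>x. norm (F x) \<le> C * indicator K x * norm (w x)"
  shows "norm (\<integral>x. F x \<partial>lebesgue) \<le> C * (LINT x:K|lebesgue. norm (w x))"
proof -
  have "norm (\<integral>x. F x \<partial>lebesgue) \<le> (\<integral>x. norm (F x) \<partial>lebesgue)" by (rule integral_norm_bound)
  also have "\<dots> \<le> (\<integral>x. C * (indicator K x *\<^sub>R norm (w x)) \<partial>lebesgue)"
    using locally_integrable_norm[OF assms(1,2)] assms(3,4)
    by (intro integral_mono') (auto simp: set_integrable_def mult.assoc)
  finally show ?thesis by (simp add: set_lebesgue_integral_def)
qed

lemma locally_integrable_scaleR:
  fixes w :: "real^'d::finite \<Rightarrow> 'b::euclidean_space" and g :: "real^'d \<Rightarrow> real"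
  assumes "locally_integrable w" "compact K" and g: "continuous_on UNIV g"
    and "\<And>x. \<bar>g x\<bar> \<le> C * indicator K x"
  shows "integrable lebesgue (\<lambda>x. g x *\<^sub>R w x)"
proof (rule Bochner_Integration.integrable_bound)
  show "integrable lebesgue (\<lambda>x. C * (indicator K x *\<^sub>R norm (w x)))"
    using locally_integrable_norm[OF assms(1,2)] by (simp add: set_integrable_def)
  have "g \<in> borel_measurable lebesgue"
    using g by (intro measurable_completion) (simp add: borel_measurable_continuous_onI)
  then show "(\<lambda>x. g x *\<^sub>R w x) \<in> borel_measurable lebesgue"
    using locally_integrable_borel_measurable[OF assms(1)] by (rule borel_measurable_scaleR)
  show "AE x in lebesgue. norm (g x *\<^sub>R w x) \<le> norm (C * (indicator K x *\<^sub>R norm (w x)))"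
  proof (rule AE_I2)
    fix x
    have "norm (g x *\<^sub>R w x) \<le> C * indicator K x * norm (w x)"
      using assms(4)[of x] by (simp add: mult_right_mono)
    then show "norm (g x *\<^sub>R w x) \<le> norm (C * (indicator K x *\<^sub>R norm (w x)))"
      by (simp add: mult.assoc)
  qed
qed

lemma locally_integrable_LINT_nth:
  fixes w :: "real^'d::finite \<Rightarrow> real^'n" and g :: "real^'d \<Rightarrow> real"
  assumes "locally_integrable w" "compact K" "continuous_on UNIV g"
    and "\<And>x. \<bar>g x\<bar> \<le> C * indicator K x"
  shows "(\<integral>x. g x * w x $ i \<partial>lebesgue) = (\<integral>x. g x *\<^sub>R w x \<partial>lebesgue) $ i"
    and "integrable lebesgue (\<lambda>x. g x * w x $ i)"
  using integral_inner_left[of "axis i 1" lebesgue "\<lambda>x. g x *\<^sub>R w x"]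
    integrable_inner_left[of "axis i 1" lebesgue "\<lambda>x. g x *\<^sub>R w x"]
    locally_integrable_scaleR[OF assms]
  by (simp_all add: inner_axis)

text \<open>The weak derivative is tested with the bump dilated to the ball. What matters is the
  order of choices: \<open>C\<close> depends on \<phi> and \<zeta> only and is fixed before
  \<open>v\<close>, \<open>f\<close>, \<open>x0\<close> and \<open>r\<close>.\<close>

lemma weak_deriv_average_bound:
  fixes \<phi> :: "real^'d::finite \<Rightarrow> real"
  assumes \<phi>: "smooth \<phi>" "\<And>x. 1 \<le> norm x \<Longrightarrow> \<phi> x = 0"
  obtains C where "0 \<le> C"
    "\<And>(v :: real^'d \<Rightarrow> real^'n) f i x0 r. 0 < r \<Longrightarrow> weak_deriv \<zeta> v f \<Longrightarrow>
      \<bar>\<integral>x. \<phi> ((1 / r) *\<^sub>R (x - x0)) * f x $ i \<partial>lebesgue\<bar>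
        \<le> C / r ^ mi_order \<zeta> * (LINT x:cball x0 r|lebesgue. norm (v x))"
proof -
  \<comment> \<open>The empty list of derivatives records that the dilated bump itself is bounded
    and supported in the closed ball.\<close>
  obtain B where B: "0 \<le> B" "\<And>x0 r x. 0 < r \<Longrightarrow>
      \<bar>\<phi> ((1 / r) *\<^sub>R (x - x0))\<bar> \<le> B * indicator (cball x0 r) x"
    by (rule rescaled_derivative_bound[OF \<phi>, of "[]"]) auto
  obtain C where C: "0 \<le> C" "\<And>x0 r x. 0 < r \<Longrightarrow>
      \<bar>mi_deriv \<zeta> (\<lambda>x. \<phi> ((1 / r) *\<^sub>R (x - x0))) x\<bar> \<le> C / r ^ mi_order \<zeta> * indicator (cball x0 r) x"
    by (rule rescaled_derivative_bound[OF \<phi> mi_dirs(1)[of \<zeta>]])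
       (auto simp: mi_dirs(2) mi_deriv_eq)
  show ?thesis
  proof (rule that[OF C(1)])
    fix v f :: "real^'d \<Rightarrow> real^'n" and i x0 and r :: real
    assume r: "0 < r" and vf: "weak_deriv \<zeta> v f"
    let ?\<phi> = "\<lambda>x. \<phi> ((1 / r) *\<^sub>R (x - x0))"
    have li: "locally_integrable v" "locally_integrable f" using vf by (auto simp: weak_deriv_def)
    have sm: "smooth ?\<phi>" by (rule smooth_rescale[OF \<phi>(1)])
    have "?\<phi> x = 0" if "x \<notin> cball x0 r" for x using B(2)[OF r, of x x0] that by simp
    then have "test_function ?\<phi>"
      using test_function_if_eq_0_outside[OF sm compact_cball] by blast
    then have eq: "(\<integral>x. mi_deriv \<zeta> ?\<phi> x *\<^sub>R v x \<partial>lebesgue)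
        = (-1) ^ mi_order \<zeta> *\<^sub>R (\<integral>x. ?\<phi> x *\<^sub>R f x \<partial>lebesgue)"
      using vf unfolding weak_deriv_def by blast
    have "\<bar>\<integral>x. ?\<phi> x * f x $ i \<partial>lebesgue\<bar> = \<bar>(\<integral>x. ?\<phi> x *\<^sub>R f x \<partial>lebesgue) $ i\<bar>"
      using locally_integrable_LINT_nth(1)[OF li(2) compact_cball smooth_continuous[OF sm] B(2)[OF r]] by simp
    also have "\<dots> \<le> norm (\<integral>x. ?\<phi> x *\<^sub>R f x \<partial>lebesgue)" by (rule component_le_norm_cart)
    also have "\<dots> = norm (\<integral>x. mi_deriv \<zeta> ?\<phi> x *\<^sub>R v x \<partial>lebesgue)" by (simp add: eq)
    also have "\<dots> \<le> C / r ^ mi_order \<zeta> * (LINT x:cball x0 r|lebesgue. norm (v x))"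
    proof (rule norm_integral_le_locally_integrable[OF li(1) compact_cball])
      show "0 \<le> C / r ^ mi_order \<zeta>" using C(1) r by simp
      show "norm (mi_deriv \<zeta> ?\<phi> x *\<^sub>R v x) \<le> C / r ^ mi_order \<zeta> * indicator (cball x0 r) x * norm (v x)" for x
        unfolding norm_scaleR by (intro mult_right_mono C(2)[OF r]) simp
    qed
    finally show "\<bar>\<integral>x. ?\<phi> x * f x $ i \<partial>lebesgue\<bar>
        \<le> C / r ^ mi_order \<zeta> * (LINT x:cball x0 r|lebesgue. norm (v x))" .
  qed
qed

text \<open>The factor 6 comes from three components, each a difference of two partial derivatives,
  with the Euclidean norm bounded by the sum of the components.\<close>

lemma norm_curl_scaleR_axis_le:
  fixes g :: "real^3 \<Rightarrow> real"
  assumes g: "smooth g" and B: "\<And>j. \<bar>partial j g x\<bar> \<le> B"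
  shows "norm (curl (\<lambda>x. g x *\<^sub>R axis i 1) x) \<le> 6 * B"
proof -
  have "partial j (\<lambda>x. g x *\<^sub>R axis i 1 :: real^3) x = partial j g x *\<^sub>R axis i 1" for j
    using foldr_dir_deriv_scaleR_const[OF g, of "[axis j 1]" "axis i 1 :: real^3"]
    by (simp add: fun_eq_iff)
  then have le: "\<bar>partial j (\<lambda>x. g x *\<^sub>R axis i 1 :: real^3) x $ l\<bar> \<le> B" for j l
    using B[of j] by (auto simp: axis_def)
  have "\<bar>curl (\<lambda>x. g x *\<^sub>R axis i 1) x $ l\<bar> \<le> 2 * B" for l
  proof -
    have sub: "\<bar>a - b\<bar> \<le> 2 * B" if "\<bar>a\<bar> \<le> B" "\<bar>b\<bar> \<le> B" for a b :: real using that by linarith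
    consider "l = 1" | "l = 2" | "l = 3" using exhaust_3 by blast
    then show ?thesis unfolding curl_def by cases (auto intro!: sub le)
  qed
  then have "(\<Sum>l\<in>UNIV. \<bar>curl (\<lambda>x. g x *\<^sub>R axis i 1) x $ l\<bar>) \<le> (\<Sum>l\<in>(UNIV::3 set). 2 * B)"
    by (rule sum_mono)
  then show ?thesis using norm_le_l1_cart[of "curl (\<lambda>x. g x *\<^sub>R axis i 1) x"] by simp
qed

text \<open>Derivatives are moved twice: first D^zeta from \<open>f\<close> onto the bump, which
  gives \<psi>, then the curl from \<omega> onto the field \<psi> e_i. The curl is formally
  self-adjoint and costs the additional factor 1 / r.\<close>

lemma weak_curl_deriv_average_bound:
  fixes \<phi> :: "real^3 \<Rightarrow> real"
  assumes \<phi>: "smooth \<phi>" "\<And>x. 1 \<le> norm x \<Longrightarrow> \<phi> x = 0"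
  obtains C where "0 \<le> C"
    "\<And>v \<omega> f i x0 r. 0 < r \<Longrightarrow> weak_curl v \<omega> \<Longrightarrow> weak_deriv \<zeta> \<omega> f \<Longrightarrow>
      \<bar>\<integral>x. \<phi> ((1 / r) *\<^sub>R (x - x0)) * f x $ i \<partial>lebesgue\<bar>
        \<le> C / r ^ Suc (mi_order \<zeta>) * (LINT x:cball x0 r|lebesgue. norm (v x))"
proof -
  obtain B where B: "0 \<le> B" "\<And>x0 r x. 0 < r \<Longrightarrow>
      \<bar>\<phi> ((1 / r) *\<^sub>R (x - x0))\<bar> \<le> B * indicator (cball x0 r) x"
    by (rule rescaled_derivative_bound[OF \<phi>, of "[]"]) auto
  obtain B' where B': "0 \<le> B'" "\<And>x0 r x. 0 < r \<Longrightarrow>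
      \<bar>mi_deriv \<zeta> (\<lambda>x. \<phi> ((1 / r) *\<^sub>R (x - x0))) x\<bar> \<le> B' / r ^ mi_order \<zeta> * indicator (cball x0 r) x"
    by (rule rescaled_derivative_bound[OF \<phi> mi_dirs(1)[of \<zeta>]])
       (auto simp: mi_dirs(2) mi_deriv_eq)
  have "\<exists>C. 0 \<le> C \<and> (\<forall>x0 r x. 0 < r \<longrightarrow>
      \<bar>partial j (mi_deriv \<zeta> (\<lambda>x. \<phi> ((1 / r) *\<^sub>R (x - x0)))) x\<bar>
        \<le> C / r ^ Suc (mi_order \<zeta>) * indicator (cball x0 r) x)" for j
  proof -
    have "set (axis j 1 # mi_dirs \<zeta>) \<subseteq> Basis" using mi_dirs(1)[of \<zeta>] by simp
    from rescaled_derivative_bound[OF \<phi> this] show ?thesis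
      by (simp only: mi_dirs(2) mi_deriv_eq foldr.simps o_apply list.size add_Suc_right add_0_right) metis
  qed
  then obtain C where C: "\<And>j. 0 \<le> C j" "\<And>j x0 r x. 0 < r \<Longrightarrow>
      \<bar>partial j (mi_deriv \<zeta> (\<lambda>x. \<phi> ((1 / r) *\<^sub>R (x - x0)))) x\<bar>
        \<le> C j / r ^ Suc (mi_order \<zeta>) * indicator (cball x0 r) x"
    by metis
  \<comment> \<open>A single constant for all three directions that the curl differentiates
    in.\<close>
  define A where "A = (\<Sum>j\<in>UNIV. C j)"
  have A: "0 \<le> A" "C j \<le> A" for j
    using C(1) by (auto simp: A_def intro!: sum_nonneg member_le_sum)
  show ?thesis
  proof (rule that)
    show "0 \<le> 6 * A" using A by simp
    fix v \<omega> f :: "real^3 \<Rightarrow> real^3" and i x0 and r :: real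
    assume r: "0 < r" and v\<omega>: "weak_curl v \<omega>" and \<omega>f: "weak_deriv \<zeta> \<omega> f"
    let ?\<phi> = "\<lambda>x. \<phi> ((1 / r) *\<^sub>R (x - x0))" and ?s = "r ^ Suc (mi_order \<zeta>)"
    define \<psi> where "\<psi> = mi_deriv \<zeta> ?\<phi>"
    have li: "locally_integrable v" "locally_integrable \<omega>" "locally_integrable f"
      using v\<omega> \<omega>f by (auto simp: weak_deriv_def weak_curl_def)
    have sm: "smooth ?\<phi>" by (rule smooth_rescale[OF \<phi>(1)])
    then have sm': "smooth \<psi>" unfolding \<psi>_def mi_deriv_eq by (rule smooth_foldr_dir_deriv[OF _ mi_dirs(1)])
    have "?\<phi> x = 0" if "x \<notin> cball x0 r" for x using B(2)[OF r, of x x0] that by simp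
    then have "test_function ?\<phi>"
      using test_function_if_eq_0_outside[OF sm compact_cball] by blast
    then have eq: "(\<integral>x. \<psi> x *\<^sub>R \<omega> x \<partial>lebesgue)
        = (-1) ^ mi_order \<zeta> *\<^sub>R (\<integral>x. ?\<phi> x *\<^sub>R f x \<partial>lebesgue)"
      using \<omega>f unfolding weak_deriv_def \<psi>_def by blast
    have "\<psi> x = 0" if "x \<notin> cball x0 r" for x using B'(2)[OF r, of x0 x] that by (simp add: \<psi>_def)
    then have "test_function (\<lambda>x. \<psi> x *\<^sub>R axis i 1 :: real^3)"
      by (intro test_function_if_eq_0_outside[OF smooth_scaleR_const[OF sm'] compact_cball]) auto
    then have curl: "(\<integral>x. \<omega> x \<bullet> (\<psi> x *\<^sub>R axis i 1) \<partial>lebesgue)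
        = (\<integral>x. v x \<bullet> curl (\<lambda>x. \<psi> x *\<^sub>R axis i 1) x \<partial>lebesgue)"
      using v\<omega> unfolding weak_curl_def by blast
    have bd: "norm (v x \<bullet> curl (\<lambda>x. \<psi> x *\<^sub>R axis i 1) x)
        \<le> 6 * A / ?s * indicator (cball x0 r) x * norm (v x)" for x
    proof -
      have "\<bar>partial j \<psi> x\<bar> \<le> A / ?s * indicator (cball x0 r) x" for j
      proof -
        have "C j / ?s * indicator (cball x0 r) x \<le> A / ?s * indicator (cball x0 r) x"
          using A(2)[of j] r by (intro mult_right_mono divide_right_mono) auto
        then show ?thesis using C(2)[OF r, of j x0 x] unfolding \<psi>_def by linarith
      qed
      from norm_curl_scaleR_axis_le[OF sm' this]
      have "norm (curl (\<lambda>x. \<psi> x *\<^sub>R axis i 1) x) \<le> 6 * (A / ?s * indicator (cball x0 r) x)" .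
      then have "norm (v x) * norm (curl (\<lambda>x. \<psi> x *\<^sub>R axis i 1) x)
          \<le> norm (v x) * (6 * (A / ?s * indicator (cball x0 r) x))"
        by (intro mult_left_mono) auto
      with Cauchy_Schwarz_ineq2[of "v x" "curl (\<lambda>x. \<psi> x *\<^sub>R axis i 1) x"] show ?thesis
        by (simp add: algebra_simps)
    qed
    have "\<bar>\<integral>x. ?\<phi> x * f x $ i \<partial>lebesgue\<bar> = \<bar>(\<integral>x. ?\<phi> x *\<^sub>R f x \<partial>lebesgue) $ i\<bar>"
      using locally_integrable_LINT_nth(1)[OF li(3) compact_cball smooth_continuous[OF sm] B(2)[OF r]] by simp
    also have "\<dots> = \<bar>(\<integral>x. \<psi> x *\<^sub>R \<omega> x \<partial>lebesgue) $ i\<bar>"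
      by (simp add: eq abs_mult)
    also have "(\<integral>x. \<psi> x *\<^sub>R \<omega> x \<partial>lebesgue) $ i = (\<integral>x. \<psi> x * \<omega> x $ i \<partial>lebesgue)"
      using locally_integrable_LINT_nth(1)[OF li(2) compact_cball smooth_continuous[OF sm'] B'(2)[OF r, of x0, folded \<psi>_def]]
      by simp
    also have "\<dots> = (\<integral>x. v x \<bullet> curl (\<lambda>x. \<psi> x *\<^sub>R axis i 1) x \<partial>lebesgue)"
      using curl by (simp add: inner_axis mult.commute)
    also have "\<bar>\<dots>\<bar> \<le> 6 * A / ?s * (LINT x:cball x0 r|lebesgue. norm (v x))"
      using norm_integral_le_locally_integrable[OF li(1) compact_cball _ bd] A r by simp
    finally show "\<bar>\<integral>x. ?\<phi> x * f x $ i \<partial>lebesgue\<bar>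
        \<le> 6 * A / ?s * (LINT x:cball x0 r|lebesgue. norm (v x))" .
  qed
qed

text \<open>This replaces Hoelder's inequality: \<open>|v| \<le> s + s powr (1 - p) * |v| powr p\<close> is integrated over the ball, with \<open>s = (\<parallel>v\<parallel>\<^sub>p + 1) * |B| powr (- 1 / p)\<close>.\<close>

lemma in_Lp_ball_average:
  fixes v :: "real^'d::finite \<Rightarrow> real^'d"
  assumes p: "1 \<le> p" and v: "in_Lp p v" and r: "0 < r"
  shows "(LINT x:cball x0 r|lebesgue. norm (v x))
    \<le> 2 * (Lp_norm p v + 1) * measure lebesgue (ball x0 r) powr (1 - 1 / p)"
proof -
  define V where "V = measure lebesgue (ball x0 r)"
  define N where "N = Lp_norm p v"
  define I where "I = (\<integral>x. norm (v x) powr p \<partial>lebesgue)"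
  \<comment> \<open>With this \<open>s\<close> each of the two terms integrates to at most (N + 1)
    V^(1 - 1/p), whence the factor 2. The summand 1 keeps \<open>s\<close> positive even if
    \<open>v\<close> vanishes almost everywhere.\<close>
  define s where "s = (N + 1) * V powr (- 1 / p)"
  have V: "0 < V" using r content_ball_eq_0_iff[of x0 r] by (simp add: V_def measure_nonneg less_le)
  have cball: "measure lebesgue (cball x0 r) = V"
    using r by (simp add: V_def content_ball content_cball)
  have I: "0 \<le> I" unfolding I_def by (intro integral_nonneg_AE) auto
  have N: "0 \<le> N" unfolding N_def Lp_norm_def by simp
  have IN: "I = N powr p" using p I by (simp add: N_def Lp_norm_def I_def[symmetric] powr_powr)
  have s: "0 < s" using V N by (simp add: s_def)
  have le: "norm (v x) \<le> s + s powr (1 - p) * norm (v x) powr p" for x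
  proof (cases "norm (v x) \<le> s")
    case False
    then have n: "0 < norm (v x)" "s < norm (v x)" using s by linarith+
    then have "s powr (1 - p) * norm (v x) powr p = norm (v x) * (norm (v x) powr (p - 1) / s powr (p - 1))"
      using s by (simp add: powr_diff field_simps)
    moreover have "s powr (p - 1) \<le> norm (v x) powr (p - 1)"
      using n s p by (intro powr_mono2) auto
    then have "1 \<le> norm (v x) powr (p - 1) / s powr (p - 1)" using s by simp
    then have "norm (v x) * 1 \<le> norm (v x) * (norm (v x) powr (p - 1) / s powr (p - 1))"
      by (intro mult_left_mono) auto
    ultimately show ?thesis using s by linarith
  qed (use s in \<open>simp add: add_increasing2\<close>)
  have int: "integrable lebesgue (\<lambda>x. indicator (cball x0 r) x * s + s powr (1 - p) * norm (v x) powr p)"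
    using v by (intro Bochner_Integration.integrable_add integrable_mult_left integrable_mult_right)
       (auto simp: in_Lp_def emeasure_cball r less_imp_le)
  have "(LINT x:cball x0 r|lebesgue. norm (v x))
      \<le> (\<integral>x. indicator (cball x0 r) x * s + s powr (1 - p) * norm (v x) powr p \<partial>lebesgue)"
    unfolding set_lebesgue_integral_def
    using le s by (intro integral_mono'[OF int]) (auto simp: indicator_def add_nonneg_nonneg)
  also have "\<dots> = V * s + s powr (1 - p) * I"
    using v r by (subst Bochner_Integration.integral_add)
      (auto simp: in_Lp_def emeasure_cball less_imp_le I_def cball)
  also have "\<dots> \<le> V * s + s powr (1 - p) * (N + 1) powr p"
    unfolding IN using N p by (intro add_left_mono mult_left_mono powr_mono2) auto
  also have "V * s = (N + 1) * V powr (1 - 1 / p)"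
    using V powr_add[of V 1 "- 1 / p"] by (simp add: s_def)
  also have "s powr (1 - p) * (N + 1) powr p = (N + 1) * V powr (1 - 1 / p)"
  proof -
    have "s powr (1 - p) = (N + 1) powr (1 - p) * V powr (1 - 1 / p)"
    proof -
      have "- 1 / p * (1 - p) = 1 - 1 / p" using p by (simp add: field_simps)
      then show ?thesis using N V unfolding s_def by (subst powr_mult) (simp_all only: powr_powr)
    qed
    moreover have "(N + 1) powr (1 - p) * (N + 1) powr p = N + 1"
      using N by (simp flip: powr_add)
    ultimately show ?thesis by (simp add: mult_ac)
  qed
  finally show ?thesis by (simp add: V_def N_def algebra_simps)
qed

section \<open>Lower bounds, and bounds on the Lebesgue norms of the solution\<close>

text \<open>Upgrades statements that hold almost everywhere: in space for continuous fields, and in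
  time to find good times in every interval.\<close>

lemma AE_not_in_open_imp_empty:
  assumes "open U" "AE x in lebesgue. x \<notin> U"
  shows "U = {}"
proof -
  have "U \<in> null_sets lebesgue"
    using assms by (subst AE_iff_null_sets) auto
  then show ?thesis using open_not_negligible[OF assms(1)] by (auto simp: negligible_iff_null_sets)
qed

lemma AE_infnorm_le_Linf_norm:
  "Linf_norm f = ereal F \<Longrightarrow> AE x in lebesgue. infnorm (f x) \<le> F"
  using esssup_AE[of "\<lambda>x. ereal (infnorm (f x))" lebesgue] by (simp add: Linf_norm_def)

text \<open>The conventions \<open>real_of_ereal \<infinity> = 0\<close>,
  \<open>0 powr \<beta> = 0\<close> and \<open>1 / 0 = 0\<close> turn a positive scale into a finite
  nonzero norm. A negative one would make the whole space a null set, as \<open>infnorm\<close> is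
  nonnegative.\<close>

lemma Linf_norm_pos_if_sparse_scale_pos:
  fixes f :: "real^'d::finite \<Rightarrow> real^'d"
  assumes "0 < sparse_scale c \<beta> f"
  obtains F where "0 < F" "Linf_norm f = ereal F"
proof -
  have "real_of_ereal (Linf_norm f) \<noteq> 0"
    using assms by (auto simp: sparse_scale_def)
  then obtain F where F: "F \<noteq> 0" "Linf_norm f = ereal F"
    by (cases "Linf_norm f") auto
  have "\<not> F < 0"
  proof
    assume "F < 0"
    have "AE x in lebesgue. (x :: real^'d) \<notin> UNIV"
      using AE_infnorm_le_Linf_norm[OF F(2)]
    proof eventually_elim
      case (elim x)
      then show ?case using \<open>F < 0\<close> infnorm_pos_le[of "f x"] by linarith
    qed
    then show False using AE_not_in_open_imp_empty[of "UNIV :: (real^'d) set"] by simp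
  qed
  then show ?thesis using F by (intro that) auto
qed

lemma infnorm_le_Linf_norm_if_continuous:
  fixes f :: "real^'d::finite \<Rightarrow> real^'d"
  assumes "continuous_on UNIV f" "Linf_norm f = ereal F"
  shows "infnorm (f x) \<le> F"
proof -
  have "continuous_on UNIV (\<lambda>x. infnorm (f x))"
    using assms(1) by (simp add: continuous_on_def tendsto_infnorm)
  then have "open {x. F < infnorm (f x)}" by (intro open_Collect_less continuous_on_const)
  moreover have "AE x in lebesgue. x \<notin> {x. F < infnorm (f x)}"
    using AE_infnorm_le_Linf_norm[OF assms(2)] by (simp add: not_less)
  ultimately have "{x. F < infnorm (f x)} = {}" by (rule AE_not_in_open_imp_empty)
  then show ?thesis by (auto simp: not_less)
qed

lemma measure_ball_rescale:
  fixes x0 :: "real^'d::finite"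
  assumes "0 \<le> \<rho>" "0 \<le> r"
  shows "measure lebesgue (ball x0 (\<rho> * r)) = \<rho> ^ CARD('d) * measure lebesgue (ball x0 r)"
  using assms by (simp add: content_ball power_mult_distrib)

text \<open>The bump costs \<eta> twice: as a height, since \<phi> is only known to be at least 1 -
  \<eta> on the concentric ball \<open>B'\<close>, and as a volume, since at most the fraction
  \<eta> of \<open>B\<close> lies outside \<open>B'\<close>. This explains the product (1 - \<eta>)
  (\<delta> - \<eta>) in the gain, while the loss 1 - \<delta> comes from the part of
  \<open>B\<close> outside the super-level set.\<close>

lemma average_ge_if_not_sparse:
  fixes f :: "real^'d::finite \<Rightarrow> real^'d" and \<phi> :: "real^'d \<Rightarrow> real"
  assumes f: "locally_integrable f" "Linf_norm f = ereal F" "0 < F"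
    and \<phi>: "continuous_on UNIV \<phi>" "\<And>x. 0 \<le> \<phi> x" "\<And>x. \<phi> x \<le> 1" "\<And>x. 1 \<le> norm x \<Longrightarrow> \<phi> x = 0"
      "\<And>x. norm x \<le> \<rho> \<Longrightarrow> 1 - \<eta> \<le> \<phi> x"
    and \<rho>: "0 < \<rho>" "\<rho> < 1" "1 - \<eta> \<le> \<rho> ^ CARD('d)" and \<eta>: "\<eta> < 1"
    and lam: "0 < lam" and \<sigma>: "\<sigma> \<in> {1, -1}" and r: "0 < r"
    and not_sparse: "\<not> sparse_around \<delta> r (super_level lam \<sigma> i f) x0"
  shows "F * measure lebesgue (ball x0 r) * (lam * (1 - \<eta>) * (\<delta> - \<eta>) - (1 - \<delta>))
    \<le> \<bar>\<integral>x. \<phi> ((1 / r) *\<^sub>R (x - x0)) * f x $ i \<partial>lebesgue\<bar>"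
proof -
  define B where "B = ball x0 r"
  define B' where "B' = ball x0 (\<rho> * r)"
  define V where "V = measure lebesgue B"
  define S where "S = super_level lam \<sigma> i f"
  define g where "g x = \<phi> ((1 / r) *\<^sub>R (x - x0))" for x
  \<comment> \<open>A positive threshold is exceeded by \<open>max y 0\<close> exactly when it is
    exceeded by \<open>y\<close>.\<close>
  have S: "S = {x. lam * F < \<sigma> * f x $ i}"
    using f(2,3) lam by (auto simp: S_def super_level_def comp_part_def less_max_iff_disj dest: less_trans[OF mult_pos_pos])
  have "f \<in> borel_measurable lebesgue" by (rule locally_integrable_borel_measurable[OF f(1)])
  then have "(\<lambda>x. f x \<bullet> axis i 1) \<in> borel_measurable lebesgue" by (intro borel_measurable_inner) auto
  then have "(\<lambda>x. f x $ i) \<in> borel_measurable lebesgue" by (simp add: inner_axis)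
  then have "{x \<in> space lebesgue. lam * F < \<sigma> * f x $ i} \<in> sets lebesgue" by measurable
  then have meas_S: "S \<in> sets lebesgue" by (simp add: S)
  have fin: "B \<in> fmeasurable lebesgue" "B' \<in> fmeasurable lebesgue"
    by (simp_all add: B_def B'_def lmeasurable_ball)
  have "B' \<subseteq> B" unfolding B'_def B_def
    using \<rho> r mult_left_le_one_le[of r \<rho>] by (intro subset_ball) auto
  have V: "0 < V" using r content_ball_eq_0_iff[of x0 r] by (simp add: V_def B_def measure_nonneg less_le)
  have SB: "S \<inter> B \<in> fmeasurable lebesgue" "S \<inter> B' \<in> fmeasurable lebesgue" "B - S \<in> fmeasurable lebesgue"
    using fin meas_S by (auto intro: fmeasurable_Int_fmeasurable simp: Int_commute fmeasurable_Diff)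
  have dense: "\<delta> * V < measure lebesgue (S \<inter> B)"
    using not_sparse V by (simp add: sparse_around_def S_def V_def B_def not_le field_simps)
  have "measure lebesgue B' = \<rho> ^ CARD('d) * V"
    unfolding B'_def V_def B_def using \<rho> r by (intro measure_ball_rescale) auto
  then have "(1 - \<eta>) * V \<le> measure lebesgue B'" using \<rho>(3) V by simp
  moreover have "measure lebesgue (B - B') = V - measure lebesgue B'"
    unfolding V_def using fin \<open>B' \<subseteq> B\<close> by (intro measurable_measure_Diff) auto
  moreover have "measure lebesgue (S \<inter> B) \<le> measure lebesgue (S \<inter> B') + measure lebesgue (B - B')"
  proof -
    have BB: "B - B' \<in> fmeasurable lebesgue" using fin by (simp add: fmeasurable_Diff fmeasurableD)
    then have "measure lebesgue (S \<inter> B) \<le> measure lebesgue ((S \<inter> B') \<union> (B - B'))"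
      using SB by (intro measure_mono_fmeasurable fmeasurable.Un) (auto dest: fmeasurableD)
    also have "\<dots> \<le> measure lebesgue (S \<inter> B') + measure lebesgue (B - B')"
      using SB BB by (intro measure_Un_le) (auto dest: fmeasurableD)
    finally show ?thesis .
  qed
  ultimately have large: "(\<delta> - \<eta>) * V \<le> measure lebesgue (S \<inter> B')"
    using dense by (simp add: algebra_simps)
  have "measure lebesgue (B - S) = V - measure lebesgue (S \<inter> B)"
    unfolding V_def using measurable_measure_Diff[of B lebesgue "S \<inter> B"] fin SB(1)
    by (simp add: Diff_Int Int_commute fmeasurableD)
  then have small: "measure lebesgue (B - S) \<le> (1 - \<delta>) * V" using dense by (simp add: algebra_simps)

  have g_cont: "continuous_on UNIV g"
    unfolding g_def by (intro continuous_intros continuous_on_compose2[OF \<phi>(1)]) auto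
  have g0: "g x = 0" if "x \<notin> B" for x
  proof -
    have "r \<le> norm (x - x0)" using that by (simp add: B_def dist_norm norm_minus_commute)
    then show ?thesis unfolding g_def using r by (intro \<phi>(4)) simp
  qed
  have g1: "1 - \<eta> \<le> g x" if "x \<in> B'" for x
  proof -
    have "norm (x - x0) \<le> \<rho> * r" using that by (simp add: B'_def dist_norm norm_minus_commute)
    then show ?thesis unfolding g_def using r by (intro \<phi>(5)) (simp add: pos_divide_le_eq)
  qed
  have g01: "0 \<le> g x" "g x \<le> 1" for x by (auto simp: g_def \<phi>)
  have int: "integrable lebesgue (\<lambda>x. g x * f x $ i)"
  proof (rule locally_integrable_LINT_nth(2)[OF f(1) compact_cball g_cont])
    show "\<bar>g x\<bar> \<le> 1 * indicator (cball x0 r) x" for x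
      using g0[of x] g01[of x] by (auto simp: indicator_def B_def)
  qed
  have "F * V * (lam * (1 - \<eta>) * (\<delta> - \<eta>) - (1 - \<delta>))
      = lam * F * (1 - \<eta>) * ((\<delta> - \<eta>) * V) - F * ((1 - \<delta>) * V)"
    by (simp add: algebra_simps)
  also have "\<dots> \<le> lam * F * (1 - \<eta>) * measure lebesgue (S \<inter> B') - F * measure lebesgue (B - S)"
    using large small lam f(3) \<eta> by (intro diff_mono mult_left_mono) auto
  also have "\<dots> = (\<integral>x. lam * F * (1 - \<eta>) * indicator (S \<inter> B') x - F * indicator (B - S) x \<partial>lebesgue)"
    using SB(2,3) by (subst Bochner_Integration.integral_diff) (auto simp: fmeasurable_def less_top[symmetric])
  also have "\<dots> \<le> (\<integral>x. \<sigma> * (g x * f x $ i) \<partial>lebesgue)"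
  proof (rule integral_mono_AE)
    show "integrable lebesgue (\<lambda>x. lam * F * (1 - \<eta>) * indicator (S \<inter> B') x - F * indicator (B - S) x)"
      using SB(2,3) by (intro Bochner_Integration.integrable_diff) (auto simp: fmeasurable_def less_top[symmetric])
    show "integrable lebesgue (\<lambda>x. \<sigma> * (g x * f x $ i))" using int by simp
    show "AE x in lebesgue. lam * F * (1 - \<eta>) * indicator (S \<inter> B') x - F * indicator (B - S) x
        \<le> \<sigma> * (g x * f x $ i)"
      using AE_infnorm_le_Linf_norm[OF f(2)]
    proof eventually_elim
      case (elim x)
      then have "\<bar>f x $ i\<bar> \<le> F" using component_le_infnorm_cart[of "f x" i] by linarith
      then have "- F \<le> \<sigma> * f x $ i" using \<sigma> by auto
      then have "g x * (- F) \<le> g x * (\<sigma> * f x $ i)" using g01 by (intro mult_left_mono)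
      moreover have "g x * F \<le> 1 * F" using g01 f(3) by (intro mult_right_mono) auto
      ultimately have lower: "- F \<le> \<sigma> * (g x * f x $ i)" by (simp add: mult_ac)
      \<comment> \<open>On the super-level set outside \<open>B'\<close> the integrand is merely
        nonnegative and its contribution is given up; off the super-level set, inside
        \<open>B\<close>, it is bounded below by - F.\<close>
      consider "x \<in> S \<inter> B'" | "x \<in> S" "x \<notin> B'" | "x \<notin> S" "x \<in> B" | "x \<notin> S" "x \<notin> B" by blast
      then show ?case
      proof cases
        case 1
        then have "(1 - \<eta>) * (lam * F) \<le> g x * (\<sigma> * f x $ i)"
          using g1[of x] g01(1)[of x] mult_pos_pos[OF lam f(3)]
          by (intro mult_mono[OF _ less_imp_le]) (auto simp: S)
        then show ?thesis using 1 by (simp add: mult_ac)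
      next
        case 2
        then have "0 \<le> \<sigma> * f x $ i" using mult_pos_pos[OF lam f(3)] unfolding S mem_Collect_eq by linarith
        then have "0 \<le> g x * (\<sigma> * f x $ i)" by (rule mult_nonneg_nonneg[OF g01(1)])
        then show ?thesis using 2 by (simp add: mult_ac)
      next
        case 3
        then show ?thesis using lower by simp
      next
        case 4
        then show ?thesis using g0 \<open>B' \<subseteq> B\<close> by auto
      qed
    qed
  qed
  also have "\<dots> \<le> \<bar>\<integral>x. g x * f x $ i \<partial>lebesgue\<bar>" using \<sigma> by auto
  finally show ?thesis by (simp add: g_def V_def B_def)
qed

section \<open>Lebesgue norms of the solution at a fixed time\<close>

lemma leray_solution_Lp_norm_le:
  assumes "leray_solution u0 u" "0 \<le> t"
  shows "in_Lp 2 (u t)" "Lp_norm 2 (u t) \<le> Lp_norm 2 u0"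
proof -
  show "in_Lp 2 (u t)" using assms by (simp add: leray_solution_def)
  obtain G :: "real \<Rightarrow> real^'a \<Rightarrow> real^'a^'a" where
    "(\<integral>x. (norm (u t x))\<^sup>2 \<partial>lebesgue) + 2 * (LINT (s, x) : {0<..<t} \<times> UNIV | lebesgue. (norm (G s x))\<^sup>2)
      \<le> (\<integral>x. (norm (u0 x))\<^sup>2 \<partial>lebesgue)"
    using assms unfolding leray_solution_def by blast
  moreover have "0 \<le> (LINT (s, x) : {0<..<t} \<times> UNIV | lebesgue. (norm (G s x))\<^sup>2)"
    unfolding set_lebesgue_integral_def by (intro Bochner_Integration.integral_nonneg) auto
  ultimately have "(\<integral>x. (norm (u t x))\<^sup>2 \<partial>lebesgue) \<le> (\<integral>x. (norm (u0 x))\<^sup>2 \<partial>lebesgue)"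
    by linarith
  then show "Lp_norm 2 (u t) \<le> Lp_norm 2 u0"
    unfolding Lp_norm_def by (intro powr_mono2) (auto intro: Bochner_Integration.integral_nonneg)
qed

text \<open>Fatou's lemma is applied to nonnegative integrals, so that finiteness for the limit and
  the bound on its norm come out together.\<close>

lemma in_Lp_of_pointwise_limit:
  fixes v :: "real^'d::finite \<Rightarrow> real^'d"
  assumes p: "0 < p" and M: "0 \<le> M" and v: "v \<in> borel_measurable lebesgue"
    and w: "\<And>n. in_Lp p (w n)" "\<And>n. Lp_norm p (w n) \<le> M"
    and lim: "AE x in lebesgue. (\<lambda>n::nat. w n x) \<longlonglongrightarrow> v x"
  shows "in_Lp p v" "Lp_norm p v \<le> M"
proof -
  let ?h = "\<lambda>v x. norm (v x) powr p"
  have nn: "(\<integral>\<^sup>+x. ennreal (?h (w n) x) \<partial>lebesgue) \<le> ennreal (M powr p)" for n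
  proof -
    have "(\<integral>\<^sup>+x. ennreal (?h (w n) x) \<partial>lebesgue) = ennreal (\<integral>x. ?h (w n) x \<partial>lebesgue)"
      using w(1)[of n] by (intro nn_integral_eq_integral) (auto simp: in_Lp_def)
    also have "(\<integral>x. ?h (w n) x \<partial>lebesgue) = Lp_norm p (w n) powr p"
      using p by (simp add: Lp_norm_def powr_powr integral_nonneg_AE)
    also have "\<dots> \<le> M powr p"
      using w(2)[of n] p by (intro powr_mono2) (auto simp: Lp_norm_def)
    finally show ?thesis by (simp add: ennreal_leI)
  qed
  have "(\<integral>\<^sup>+x. ennreal (?h v x) \<partial>lebesgue) = (\<integral>\<^sup>+x. liminf (\<lambda>n. ennreal (?h (w n) x)) \<partial>lebesgue)"
  proof (rule nn_integral_cong_AE)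
    show "AE x in lebesgue. ennreal (?h v x) = liminf (\<lambda>n. ennreal (?h (w n) x))"
      using lim
    proof eventually_elim
      case (elim x)
      have "(\<lambda>n. ?h (w n) x) \<longlonglongrightarrow> ?h v x"
        using p by (intro tendsto_powr2 tendsto_norm elim tendsto_const) auto
      then show ?case by (intro lim_imp_Liminf[symmetric] tendsto_ennrealI) auto
    qed
  qed
  also have "\<dots> \<le> liminf (\<lambda>n. \<integral>\<^sup>+x. ennreal (?h (w n) x) \<partial>lebesgue)"
    using w(1) by (intro nn_integral_liminf) (auto simp: in_Lp_def)
  also have "\<dots> \<le> liminf (\<lambda>n::nat. ennreal (M powr p))"
    by (intro Liminf_mono always_eventually allI nn)
  also have "\<dots> = ennreal (M powr p)" by (simp add: Liminf_const)
  finally have le: "(\<integral>\<^sup>+x. ennreal (?h v x) \<partial>lebesgue) \<le> ennreal (M powr p)" .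
  have "integrable lebesgue (?h v)"
    using v le by (intro integrableI_nonneg) (auto simp: le_less_trans)
  then show "in_Lp p v" using v by (simp add: in_Lp_def)
  have "ennreal (\<integral>x. ?h v x \<partial>lebesgue) \<le> ennreal (M powr p)"
    using le \<open>integrable lebesgue (?h v)\<close> by (subst (asm) nn_integral_eq_integral) auto
  then have "(\<integral>x. ?h v x \<partial>lebesgue) \<le> M powr p" by simp
  then have "(\<integral>x. ?h v x \<partial>lebesgue) powr (1 / p) \<le> (M powr p) powr (1 / p)"
    using p by (intro powr_mono2) (auto intro: integral_nonneg_AE)
  then show "Lp_norm p v \<le> M" using p M by (simp add: Lp_norm_def powr_powr)
qed

text \<open>The assumed bound holds at almost every time only, whereas the supremum in the theorem
  runs over all times. Good times accumulate at every t, and convergence in L^\<infinity> along them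
  implies convergence almost everywhere in space.\<close>

lemma ess_bounded_in_Lp_imp_bounded:
  fixes u :: "real \<Rightarrow> real^'d::finite \<Rightarrow> real^'d"
  assumes p: "0 < p" and T: "0 < T" and cont: "continuous_in_Linf T u" and ess: "ess_bounded_in_Lp p T u"
  obtains M where "\<And>t. t \<in> {0<..<T} \<Longrightarrow> in_Lp p (u t) \<and> Lp_norm p (u t) \<le> M"
proof -
  obtain M where M: "AE s in lebesgue. 0 < s \<and> s \<le> T \<longrightarrow> in_Lp p (u s) \<and> Lp_norm p (u s) \<le> M"
    using ess by (auto simp: ess_bounded_in_Lp_def)
  have good: "\<exists>s\<in>{a<..<b}. in_Lp p (u s) \<and> Lp_norm p (u s) \<le> M" if "0 \<le> a" "a < b" "b \<le> T" for a b
  proof (rule ccontr)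
    assume *: "\<not> ?thesis"
    have "AE s in lebesgue. s \<notin> {a<..<b}"
      using M by eventually_elim (use * that in force)
    then have "{a<..<b} = {}" by (intro AE_not_in_open_imp_empty) auto
    then show False using that by auto
  qed
  have "0 \<le> M"
  proof -
    obtain s where "Lp_norm p (u s) \<le> M" using good[of 0 T] T by auto
    then show ?thesis by (rule order_trans[rotated]) (simp add: Lp_norm_def)
  qed
  show ?thesis
  proof
    fix t assume t: "t \<in> {0<..<T}"
    have "\<exists>s. in_Lp p (u s) \<and> Lp_norm p (u s) \<le> M \<and>
        Linf_norm (\<lambda>x. u s x - u t x) < ereal (1 / real (Suc n))" for n
    proof -
      have "eventually (\<lambda>s. Linf_norm (\<lambda>x. u s x - u t x) < ereal (1 / real (Suc n))) (at t)"
        using cont t by (intro order_tendstoD(2)[of _ 0]) (auto simp: continuous_in_Linf_def)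
      then obtain e where e: "0 < e" "\<And>s. s \<noteq> t \<Longrightarrow> dist s t < e \<Longrightarrow>
          Linf_norm (\<lambda>x. u s x - u t x) < ereal (1 / real (Suc n))"
        by (auto simp: eventually_at)
      \<comment> \<open>Times strictly to the right of \<open>t\<close> are taken because the limit
        at \<open>t\<close> is punctured, and they are cut off at \<open>T\<close>, where the
        essential bound ends.\<close>
      obtain s where s: "s \<in> {t<..<min T (t + e)}" "in_Lp p (u s)" "Lp_norm p (u s) \<le> M"
        using good[of t "min T (t + e)"] t e(1) by auto
      then have "Linf_norm (\<lambda>x. u s x - u t x) < ereal (1 / real (Suc n))"
        by (intro e(2)) (auto simp: dist_real_def)
      then show ?thesis using s by blast
    qed
    then obtain s where s: "\<And>n. in_Lp p (u (s n))" "\<And>n. Lp_norm p (u (s n)) \<le> M"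
      "\<And>n. Linf_norm (\<lambda>x. u (s n) x - u t x) < ereal (1 / real (Suc n))"
      by metis
    have "AE x in lebesgue. \<forall>n. infnorm (u (s n) x - u t x) \<le> 1 / real (Suc n)"
    proof (subst AE_all_countable, rule allI)
      fix n
      show "AE x in lebesgue. infnorm (u (s n) x - u t x) \<le> 1 / real (Suc n)"
        using esssup_AE[of "\<lambda>x. ereal (infnorm (u (s n) x - u t x))" lebesgue, folded Linf_norm_def]
      proof eventually_elim
        case (elim x)
        then have "ereal (infnorm (u (s n) x - u t x)) \<le> ereal (1 / real (Suc n))"
          using s(3)[of n] by (meson order.trans order.strict_implies_order)
        then show ?case by simp
      qed
    qed
    then have "AE x in lebesgue. (\<lambda>n. u (s n) x) \<longlonglongrightarrow> u t x"
    proof eventually_elim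
      case (elim x)
      have "(\<lambda>n. u (s n) x - u t x) \<longlonglongrightarrow> 0"
      proof (rule Lim_null_comparison)
        show "eventually (\<lambda>n. norm (u (s n) x - u t x)
            \<le> sqrt (real DIM(real^'d)) * (1 / real (Suc n))) sequentially"
        proof (intro always_eventually allI)
          fix n
          have "norm (u (s n) x - u t x) \<le> sqrt (real DIM(real^'d)) * infnorm (u (s n) x - u t x)"
            by (rule norm_le_infnorm)
          also have "\<dots> \<le> sqrt (real DIM(real^'d)) * (1 / real (Suc n))"
            using elim by (intro mult_left_mono) auto
          finally show "norm (u (s n) x - u t x) \<le> sqrt (real DIM(real^'d)) * (1 / real (Suc n))" .
        qed
        show "(\<lambda>n. sqrt (real DIM(real^'d)) * (1 / real (Suc n))) \<longlonglongrightarrow> 0"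
          using tendsto_mult[OF tendsto_const LIMSEQ_inverse_real_of_nat] by (simp add: inverse_eq_divide)
      qed
      then show ?case by (simp add: LIM_zero_iff)
    qed
    moreover have "u t \<in> borel_measurable lebesgue"
      using cont t by (auto simp: continuous_in_Linf_def in_Linf_def)
    ultimately show "in_Lp p (u t) \<and> Lp_norm p (u t) \<le> M"
      by (intro conjI in_Lp_of_pointwise_limit[OF p \<open>0 \<le> M\<close> _ s(1,2)])
  qed
qed

section \<open>Sparseness\<close>

text \<open>Supplies an inner radius whose ball keeps the fraction 1 - \<eta> of the volume in
  dimension \<open>d\<close>.\<close>

lemma Bernoulli_margin:
  fixes d :: nat
  assumes "0 < \<eta>" "\<eta> < 1" "0 < d"
  shows "0 < 1 - \<eta> / (2 * real d)" "1 - \<eta> / (2 * real d) < 1" "1 - \<eta> \<le> (1 - \<eta> / (2 * real d)) ^ d"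
proof -
  have "\<eta> / (2 * real d) < 1" using assms by (simp add: divide_less_eq)
  then show "0 < 1 - \<eta> / (2 * real d)" by simp
  show "1 - \<eta> / (2 * real d) < 1" using assms by simp
  have "1 + real d * (- (\<eta> / (2 * real d))) \<le> (1 + - (\<eta> / (2 * real d))) ^ d"
    using \<open>\<eta> / (2 * real d) < 1\<close> by (intro Bernoulli_inequality) auto
  then show "1 - \<eta> \<le> (1 - \<eta> / (2 * real d)) ^ d" using assms by simp
qed

text \<open>The only link between \<open>f\<close> and \<open>v\<close> that the sparseness argument
  uses. It holds with m = k for the velocity and m = k + 1 for the vorticity, so both cases share
  one proof.\<close>

definition averages_bounded ::
  "(real^'d \<Rightarrow> real) \<Rightarrow> real \<Rightarrow> nat \<Rightarrow> (real^'d \<Rightarrow> real^'d) \<Rightarrow> (real^'d \<Rightarrow> real^'d::finite) \<Rightarrow> bool" where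
  "averages_bounded \<phi> C m v f \<longleftrightarrow> (\<forall>i x0 r. 0 < r \<longrightarrow>
     \<bar>\<integral>x. \<phi> ((1 / r) *\<^sub>R (x - x0)) * f x $ i \<partial>lebesgue\<bar>
       \<le> C / r ^ m * (LINT x:cball x0 r|lebesgue. norm (v x)))"

definition sparse_at_scale ::
  "real \<Rightarrow> real \<Rightarrow> real \<Rightarrow> real \<Rightarrow> (real^'d \<Rightarrow> real^'d::finite) \<Rightarrow> bool" where
  "sparse_at_scale lam \<delta> c \<alpha> f \<longleftrightarrow> (0 < sparse_scale c \<alpha> f \<longrightarrow>
     (\<forall>i. \<forall>\<sigma>\<in>{1, -1}. \<forall>x0. sparse_around \<delta> (sparse_scale c \<alpha> f) (super_level lam \<sigma> i f) x0) \<and>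
     (continuous_on UNIV f \<longrightarrow> (\<forall>K\<ge>1. f \<in> Z_class K \<alpha> lam \<delta> c)))"

lemma in_Z_class_if_sparse:
  fixes f :: "real^'d::finite \<Rightarrow> real^'d"
  assumes "continuous_on UNIV f" "Linf_norm f = ereal F" "0 \<le> c" "1 \<le> K"
    and sparse: "\<And>i \<sigma> x0. \<sigma> \<in> {1, -1} \<Longrightarrow> sparse_around \<delta> (sparse_scale c \<alpha> f) (super_level lam \<sigma> i f) x0"
  shows "f \<in> Z_class K \<alpha> lam \<delta> c"
proof -
  have "norm (f x) \<le> sqrt (real DIM(real^'d)) * F" for x
    using norm_le_infnorm[of "f x"] infnorm_le_Linf_norm_if_continuous[OF assms(1,2), of x]
    by (smt (verit) mult_left_mono real_sqrt_ge_zero of_nat_0_le_iff)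
  then have "bounded (range f)" by (auto simp: bounded_iff)
  \<comment> \<open>The constant itself is the comparable one, for every admissible
    \<open>K\<close>.\<close>
  moreover have "c / K \<le> c" "c \<le> K * c"
    using assms(3,4) by (auto simp: divide_le_eq mult_le_cancel_left1 mult_le_cancel_right1)
  ultimately show ?thesis
    using assms(1) sparse unfolding Z_class_def sparse_scale_def powr_minus_divide by blast
qed

text \<open>The bump is delivered first because \<open>C\<close> is computed from it, and the
  function \<open>c\<close> from \<open>C\<close> in turn; the quantifiers follow this
  dependence.\<close>

lemma sparse_if_averages_bounded:
  fixes lam \<delta> p :: real
  assumes lam: "0 < lam" "lam < 1" and \<delta>: "1 / (1 + lam) < \<delta>" "\<delta> < 1" and p: "1 \<le> p"
  obtains \<phi> :: "real^'d::finite \<Rightarrow> real" where "smooth \<phi>" "\<And>x. 1 \<le> norm x \<Longrightarrow> \<phi> x = 0"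
    "\<And>C m. 0 \<le> C \<Longrightarrow> \<exists>c. (\<forall>M. 0 < c M) \<and> (\<forall>v f M. in_Lp p v \<longrightarrow> Lp_norm p v \<le> M \<longrightarrow>
      locally_integrable f \<longrightarrow> averages_bounded \<phi> C m v f \<longrightarrow>
      sparse_at_scale lam \<delta> (c M) (1 / (real m + real CARD('d) / p)) f)"
proof -
  \<comment> \<open>A quarter of the available gap: the bump loses at most 2 lam \<eta>, so the
    margin \<open>e\<close> below is still at least 2 \<eta>.\<close>
  define \<eta> where "\<eta> = (\<delta> * (1 + lam) - 1) / 4"
  have gap: "1 < \<delta> * (1 + lam)" using \<delta>(1) lam by (simp add: divide_less_eq)
  moreover have "\<delta> * (1 + lam) < 1 * 2" using \<delta> lam gap by (intro mult_strict_mono) auto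
  ultimately have \<eta>: "0 < \<eta>" "\<eta> < 1" by (auto simp: \<eta>_def)
  define e where "e = lam * (1 - \<eta>) * (\<delta> - \<eta>) - (1 - \<delta>)"
  have e: "0 < e"
  proof -
    have "\<delta> * \<eta> \<le> \<eta>" "0 \<le> \<eta> * \<eta>" using \<delta> \<eta> by (simp_all add: mult_left_le_one_le mult_left_le)
    moreover have "(1 - \<eta>) * (\<delta> - \<eta>) = \<delta> - \<eta> - \<delta> * \<eta> + \<eta> * \<eta>" by (simp add: algebra_simps)
    ultimately have "\<delta> - 2 * \<eta> \<le> (1 - \<eta>) * (\<delta> - \<eta>)" by linarith
    then have "lam * (\<delta> - 2 * \<eta>) \<le> lam * ((1 - \<eta>) * (\<delta> - \<eta>))" using lam by (intro mult_left_mono) auto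
    moreover have "lam * \<eta> \<le> \<eta>" using lam \<eta> by (simp add: mult_left_le_one_le)
    moreover have "lam * (\<delta> - 2 * \<eta>) = \<delta> * lam - 2 * (lam * \<eta>)" by (simp add: algebra_simps)
    moreover have "4 * \<eta> = \<delta> * (1 + lam) - 1" by (simp add: \<eta>_def)
    moreover have "\<delta> * (1 + lam) = \<delta> + \<delta> * lam" by (simp add: distrib_left)
    ultimately show ?thesis using \<eta>(1) unfolding e_def mult.assoc by linarith
  qed
  define \<rho> where "\<rho> = 1 - \<eta> / (2 * real CARD('d))"
  note \<rho> = Bernoulli_margin[OF \<eta> zero_less_card_finite[where ?'a='d], folded \<rho>_def]
  obtain \<phi> :: "real^'d \<Rightarrow> real" where \<phi>: "smooth \<phi>" "\<And>x. 0 \<le> \<phi> x" "\<And>x. \<phi> x \<le> 1"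
    "\<And>x. 1 \<le> norm x \<Longrightarrow> \<phi> x = 0" "\<And>x. norm x \<le> \<rho> \<Longrightarrow> 1 - \<eta> \<le> \<phi> x"
    using bump_function_exists[OF \<eta>(1) \<rho>(1,2)] by blast
  define w where "w = unit_ball_vol (real CARD('d)) powr (1 / p)"
  have ball_vol: "0 < unit_ball_vol (real CARD('d))" by simp
  have w: "0 < w" using less_imp_neq[OF ball_vol] unfolding w_def powr_gt_zero by simp
  show ?thesis
  proof (rule that[OF \<phi>(1,4)])
    fix C :: real and m :: nat assume C: "0 \<le> C"
    define \<gamma> where "\<gamma> = real m + real CARD('d) / p"
    have \<gamma>: "0 < \<gamma>" using p by (simp add: \<gamma>_def add_nonneg_pos)
    \<comment> \<open>Failure of sparseness will give F r^\<gamma> e w \<le> 2 C (|M| + 1), while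
      the scale satisfies F r^\<gamma> = A. The summand 1 makes these incompatible and, with |M|,
      keeps the constant positive for every real \<open>M\<close>.\<close>
    define A where "A M = 2 * C * (\<bar>M\<bar> + 1) / (e * w) + 1" for M
    have A: "0 < A M" for M
      unfolding A_def using C e w by (intro add_nonneg_pos divide_nonneg_pos) auto
    define c where "c M = A M powr (1 / \<gamma>)" for M
    have c: "0 < c M" for M using A[of M] by (simp add: c_def)
    have "sparse_at_scale lam \<delta> (c M) (1 / \<gamma>) f"
      if v: "in_Lp p v" "Lp_norm p v \<le> M" and f: "locally_integrable f"
        and avg: "averages_bounded \<phi> C m v f" for v f M
      unfolding sparse_at_scale_def
    proof (intro impI conjI)
      assume pos: "0 < sparse_scale (c M) (1 / \<gamma>) f"
      obtain F where F: "0 < F" "Linf_norm f = ereal F"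
        using Linf_norm_pos_if_sparse_scale_pos[OF pos] by blast
      define r where "r = sparse_scale (c M) (1 / \<gamma>) f"
      have r: "0 < r" using pos by (simp add: r_def)
      have r_\<gamma>: "F * r powr \<gamma> = A M"
      proof -
        have "r = A M powr (1 / \<gamma>) / F powr (1 / \<gamma>)" by (simp add: r_def sparse_scale_def F c_def)
        then have "r powr \<gamma> = A M / F" using A[of M] F \<gamma> by (simp add: powr_divide powr_powr)
        then show ?thesis using F by simp
      qed
      show sparse: "\<forall>i. \<forall>\<sigma>\<in>{1, -1}. \<forall>x0. sparse_around \<delta> (sparse_scale (c M) (1 / \<gamma>) f) (super_level lam \<sigma> i f) x0"
        unfolding r_def[symmetric]
      proof (intro allI ballI, rule ccontr)
        fix i \<sigma> x0 assume \<sigma>: "\<sigma> \<in> {1, -1 :: real}"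
          and not_sparse: "\<not> sparse_around \<delta> r (super_level lam \<sigma> i f) x0"
        define V where "V = measure lebesgue (ball x0 r)"
        have V_eq: "V = unit_ball_vol (real CARD('d)) * r powr real CARD('d)"
          using r by (simp add: V_def content_ball powr_realpow)
        have V: "0 < V" unfolding V_eq using ball_vol r by (intro mult_pos_pos) auto
        have V_root: "V powr (1 / p) = w * r powr (real CARD('d) / p)"
          using r ball_vol by (simp add: V_eq w_def powr_mult powr_powr)
        have "F * V * e \<le> \<bar>\<integral>x. \<phi> ((1 / r) *\<^sub>R (x - x0)) * f x $ i \<partial>lebesgue\<bar>"
          unfolding V_def e_def
          by (rule average_ge_if_not_sparse[OF f F(2,1) smooth_continuous[OF \<phi>(1)] \<phi>(2-5)
                \<rho> \<eta>(2) lam(1) \<sigma> r not_sparse])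
        also have "\<dots> \<le> C / r ^ m * (LINT x:cball x0 r|lebesgue. norm (v x))" using avg r unfolding averages_bounded_def by blast
        also have "\<dots> \<le> C / r ^ m * (2 * (\<bar>M\<bar> + 1) * V powr (1 - 1 / p))"
        proof (rule mult_left_mono)
          have "(LINT x:cball x0 r|lebesgue. norm (v x)) \<le> 2 * (Lp_norm p v + 1) * V powr (1 - 1 / p)"
            unfolding V_def by (rule in_Lp_ball_average[OF p v(1) r])
          also have "\<dots> \<le> 2 * (\<bar>M\<bar> + 1) * V powr (1 - 1 / p)"
            using v(2) by (intro mult_right_mono) auto
          finally show "(LINT x:cball x0 r|lebesgue. norm (v x)) \<le> 2 * (\<bar>M\<bar> + 1) * V powr (1 - 1 / p)" .
        qed (use C r in simp)
        \<comment> \<open>Splitting V^(1 - 1/p) into V / V^(1/p) lets the volume cancel; the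
          remaining r^m V^(1/p) is w r^\<gamma>.\<close>
        also have "\<dots> = V * (2 * C * (\<bar>M\<bar> + 1) / (r ^ m * V powr (1 / p)))"
          using V r by (simp add: powr_diff)
        finally have "V * (F * e) \<le> V * (2 * C * (\<bar>M\<bar> + 1) / (r ^ m * V powr (1 / p)))"
          by (simp only: mult_ac)
        then have "F * e \<le> 2 * C * (\<bar>M\<bar> + 1) / (r ^ m * V powr (1 / p))"
          using V by (simp only: mult_le_cancel_left_pos)
        moreover have "r ^ m * V powr (1 / p) = w * r powr \<gamma>"
          using r by (simp add: V_root \<gamma>_def powr_add powr_realpow)
        ultimately have "F * e \<le> 2 * C * (\<bar>M\<bar> + 1) / (w * r powr \<gamma>)" by simp
        then have "F * r powr \<gamma> * (e * w) \<le> 2 * C * (\<bar>M\<bar> + 1)"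
          using w r by (simp add: le_divide_eq mult_ac)
        then have "A M * (e * w) \<le> 2 * C * (\<bar>M\<bar> + 1)" by (simp only: r_\<gamma>)
        moreover have "A M * (e * w) = 2 * C * (\<bar>M\<bar> + 1) + e * w"
          using e w by (simp add: A_def distrib_right)
        ultimately show False using mult_pos_pos[OF e w] by linarith
      qed
      assume "continuous_on UNIV f"
      then show "\<forall>K\<ge>1. f \<in> Z_class K (1 / \<gamma>) lam \<delta> (c M)"
        using F(2) c[of M] sparse by (intro allI impI in_Z_class_if_sparse) auto
    qed
    with c show "\<exists>c. (\<forall>M. 0 < c M) \<and> (\<forall>v f M. in_Lp p v \<longrightarrow> Lp_norm p v \<le> M \<longrightarrow>
      locally_integrable f \<longrightarrow> averages_bounded \<phi> C m v f \<longrightarrow>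
      sparse_at_scale lam \<delta> (c M) (1 / (real m + real CARD('d) / p)) f)"
      unfolding \<gamma>_def by blast
  qed
qed

section \<open>Velocity and vorticity derivatives, and the theorem\<close>

lemma weak_deriv_sparse:
  fixes \<zeta> :: "'d::finite \<Rightarrow> nat"
  assumes lam: "0 < lam \<and> lam < 1 \<and> 1 / (1 + lam) < \<delta> \<and> \<delta> < 1" and p: "1 \<le> p"
  obtains c :: "real \<Rightarrow> real" where "\<And>M. 0 < c M"
    "\<And>v f M. in_Lp p v \<Longrightarrow> Lp_norm p v \<le> M \<Longrightarrow> weak_deriv \<zeta> v f \<Longrightarrow>
      sparse_at_scale lam \<delta> (c M) (1 / (real (mi_order \<zeta>) + real CARD('d) / p)) f"
proof (rule sparse_if_averages_bounded[of lam \<delta> p])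
  fix \<phi> :: "real^'d \<Rightarrow> real"
  assume \<phi>: "smooth \<phi>" "\<And>x. 1 \<le> norm x \<Longrightarrow> \<phi> x = 0"
    and sparse: "\<And>C m. 0 \<le> C \<Longrightarrow> \<exists>c. (\<forall>M. 0 < c M) \<and> (\<forall>v f M. in_Lp p v \<longrightarrow> Lp_norm p v \<le> M \<longrightarrow>
      locally_integrable f \<longrightarrow> averages_bounded \<phi> C m v f \<longrightarrow>
      sparse_at_scale lam \<delta> (c M) (1 / (real m + real CARD('d) / p)) f)"
  show thesis
  proof (rule weak_deriv_average_bound[OF \<phi>, of \<zeta>])
    fix C assume C: "0 \<le> C" and bound: "\<And>(v :: real^'d \<Rightarrow> real^'d) f i x0 r. 0 < r \<Longrightarrow> weak_deriv \<zeta> v f \<Longrightarrow>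
      \<bar>\<integral>x. \<phi> ((1 / r) *\<^sub>R (x - x0)) * f x $ i \<partial>lebesgue\<bar>
        \<le> C / r ^ (mi_order \<zeta>) * (LINT x:cball x0 r|lebesgue. norm (v x))"
    obtain c where c: "\<And>M. 0 < c M" "\<And>v f M. in_Lp p v \<Longrightarrow> Lp_norm p v \<le> M \<Longrightarrow>
      locally_integrable f \<Longrightarrow> averages_bounded \<phi> C (mi_order \<zeta>) v f \<Longrightarrow>
      sparse_at_scale lam \<delta> (c M) (1 / (real (mi_order \<zeta>) + real CARD('d) / p)) f"
      using sparse[OF C, of "mi_order \<zeta>"] by blast
    show thesis
    proof (rule that[OF c(1)])
      fix v f :: "real^'d \<Rightarrow> real^'d" and M
      assume v: "in_Lp p v" "Lp_norm p v \<le> M" and f: "weak_deriv \<zeta> v f"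
      have "averages_bounded \<phi> C (mi_order \<zeta>) v f"
        unfolding averages_bounded_def using bound f by blast
      moreover have "locally_integrable f" using f by (simp add: weak_deriv_def)
      ultimately show "sparse_at_scale lam \<delta> (c M) (1 / (real (mi_order \<zeta>) + real CARD('d) / p)) f"
        using c(2)[OF v] by simp
    qed
  qed
qed (use lam p in auto)

lemma weak_curl_deriv_sparse:
  fixes \<zeta> :: "3 \<Rightarrow> nat"
  assumes lam: "0 < lam \<and> lam < 1 \<and> 1 / (1 + lam) < \<delta> \<and> \<delta> < 1" and p: "1 \<le> p"
  obtains c :: "real \<Rightarrow> real" where "\<And>M. 0 < c M"
    "\<And>v \<omega> f M. in_Lp p v \<Longrightarrow> Lp_norm p v \<le> M \<Longrightarrow> weak_curl v \<omega> \<Longrightarrow> weak_deriv \<zeta> \<omega> f \<Longrightarrow>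
      sparse_at_scale lam \<delta> (c M) (1 / (real (Suc (mi_order \<zeta>)) + 3 / p)) f"
proof (rule sparse_if_averages_bounded[of lam \<delta> p])
  fix \<phi> :: "real^3 \<Rightarrow> real"
  assume \<phi>: "smooth \<phi>" "\<And>x. 1 \<le> norm x \<Longrightarrow> \<phi> x = 0"
    and sparse: "\<And>C m. 0 \<le> C \<Longrightarrow> \<exists>c. (\<forall>M. 0 < c M) \<and> (\<forall>v f M. in_Lp p v \<longrightarrow> Lp_norm p v \<le> M \<longrightarrow>
      locally_integrable f \<longrightarrow> averages_bounded \<phi> C m v f \<longrightarrow>
      sparse_at_scale lam \<delta> (c M) (1 / (real m + real CARD(3) / p)) f)"
  show thesis
  proof (rule weak_curl_deriv_average_bound[OF \<phi>, of \<zeta>])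
    fix C assume C: "0 \<le> C" and bound: "\<And>v \<omega> f i x0 r. 0 < r \<Longrightarrow> weak_curl v \<omega> \<Longrightarrow> weak_deriv \<zeta> \<omega> f \<Longrightarrow>
      \<bar>\<integral>x. \<phi> ((1 / r) *\<^sub>R (x - x0)) * f x $ i \<partial>lebesgue\<bar>
        \<le> C / r ^ (Suc (mi_order \<zeta>)) * (LINT x:cball x0 r|lebesgue. norm (v x))"
    obtain c where c: "\<And>M. 0 < c M" "\<And>v f M. in_Lp p v \<Longrightarrow> Lp_norm p v \<le> M \<Longrightarrow>
      locally_integrable f \<Longrightarrow> averages_bounded \<phi> C (Suc (mi_order \<zeta>)) v f \<Longrightarrow>
      sparse_at_scale lam \<delta> (c M) (1 / (real (Suc (mi_order \<zeta>)) + real CARD(3) / p)) f"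
      using sparse[OF C, of "Suc (mi_order \<zeta>)"] by blast
    show thesis
    proof (rule that[OF c(1)])
      fix v \<omega> f :: "real^3 \<Rightarrow> real^3" and M
      assume v: "in_Lp p v" "Lp_norm p v \<le> M" and f: "weak_curl v \<omega>" "weak_deriv \<zeta> \<omega> f"
      have "averages_bounded \<phi> C (Suc (mi_order \<zeta>)) v f"
        unfolding averages_bounded_def using bound f by blast
      moreover have "locally_integrable f" using f by (simp add: weak_deriv_def)
      ultimately show "sparse_at_scale lam \<delta> (c M) (1 / (real (Suc (mi_order \<zeta>)) + 3 / p)) f"
        using c(2)[OF v] by simp
    qed
  qed
qed (use lam p in auto)

theorem theorem3p7:
  shows
  "(\<forall>(\<zeta> :: 'd::finite \<Rightarrow> nat) lam \<delta>.
      0 < lam \<and> lam < 1 \<and> 1 / (1 + lam) < \<delta> \<and> \<delta> < 1 \<longrightarrow>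
      (\<exists>c :: real \<Rightarrow> real. (\<forall>M. 0 < c M) \<and>
        (\<forall>(u0 :: real^'d \<Rightarrow> real^'d) u T t f.
           leray_solution u0 u \<and> 0 < T \<and> continuous_in_Linf T u \<and>
           t \<in> {0<..<T} \<and> weak_deriv \<zeta> (u t) f \<longrightarrow>
           (let k = real (mi_order \<zeta>); d = real CARD('d); c0 = c (Lp_norm 2 u0);
                r = sparse_scale c0 (2 / (2 * k + d)) f
            in 0 < r \<and> r \<le> 1 \<longrightarrow>
               (\<forall>i. \<forall>\<sigma>\<in>{1, -1}. \<forall>x0. sparse_around \<delta> r (super_level lam \<sigma> i f) x0) \<and>
               (continuous_on UNIV f \<longrightarrow>
                 (\<forall>K\<ge>1. f \<in> Z_class K (1 / (k + d / 2)) lam \<delta> c0))))))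
   \<and>
   (\<forall>(\<zeta> :: 3 \<Rightarrow> nat) lam \<delta>.
      0 < lam \<and> lam < 1 \<and> 1 / (1 + lam) < \<delta> \<and> \<delta> < 1 \<longrightarrow>
      (\<exists>c :: real \<Rightarrow> real. (\<forall>M. 0 < c M) \<and>
        (\<forall>(u0 :: real^3 \<Rightarrow> real^3) u T t \<omega> f.
           leray_solution u0 u \<and> 0 < T \<and> continuous_in_Linf T u \<and>
           t \<in> {0<..<T} \<and> weak_curl (u t) \<omega> \<and> weak_deriv \<zeta> \<omega> f \<longrightarrow>
           (let k = real (mi_order \<zeta>); c0 = c (Lp_norm 2 u0);
                r = sparse_scale c0 (2 / (2 * k + 5)) f
            in 0 < r \<and> r \<le> 1 \<longrightarrow>
               (\<forall>i. \<forall>\<sigma>\<in>{1, -1}. \<forall>x0. sparse_around \<delta> r (super_level lam \<sigma> i f) x0) \<and>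
               (continuous_on UNIV f \<longrightarrow>
                 (\<forall>K\<ge>1. f \<in> Z_class K (1 / (k + 5 / 2)) lam \<delta> c0))))))
   \<and>
   (\<forall>(\<zeta> :: 'd \<Rightarrow> nat) lam \<delta> p.
      0 < lam \<and> lam < 1 \<and> 1 / (1 + lam) < \<delta> \<and> \<delta> < 1 \<and> 2 < p \<longrightarrow>
      (\<exists>c :: real \<Rightarrow> real. (\<forall>M. 0 < c M) \<and>
        (\<forall>(u0 :: real^'d \<Rightarrow> real^'d) u T t f.
           leray_solution u0 u \<and> 0 < T \<and> continuous_in_Linf T u \<and> ess_bounded_in_Lp p T u \<and>
           t \<in> {0<..<T} \<and> weak_deriv \<zeta> (u t) f \<longrightarrow>
           (let k = real (mi_order \<zeta>); d = real CARD('d);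
                c0 = c (SUP s\<in>{0<..<T}. Lp_norm p (u s));
                r = sparse_scale c0 (1 / (k + d / p)) f
            in 0 < r \<and> r \<le> 1 \<longrightarrow>
               (\<forall>i. \<forall>\<sigma>\<in>{1, -1}. \<forall>x0. sparse_around \<delta> r (super_level lam \<sigma> i f) x0) \<and>
               (continuous_on UNIV f \<longrightarrow>
                 (\<forall>K\<ge>1. f \<in> Z_class K (1 / (k + d / p)) lam \<delta> c0))))))"
proof (intro conjI allI impI, goal_cases)
  case (1 \<zeta> lam \<delta>)
  then obtain c :: "real \<Rightarrow> real" where c: "\<And>M. 0 < c M"
    "\<And>(v :: real^'d \<Rightarrow> real^'d) f M. in_Lp 2 v \<Longrightarrow> Lp_norm 2 v \<le> M \<Longrightarrow> weak_deriv \<zeta> v f \<Longrightarrow>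
      sparse_at_scale lam \<delta> (c M) (1 / (real (mi_order \<zeta>) + real CARD('d) / 2)) f"
    by (rule weak_deriv_sparse[where p=2 and \<zeta>=\<zeta>]) auto
  have exponent: "2 / (2 * real (mi_order \<zeta>) + real CARD('d)) = 1 / (real (mi_order \<zeta>) + real CARD('d) / 2)"
    by (simp add: divide_simps)
  show ?case
    unfolding Let_def exponent
  proof (rule exI[of _ c], intro conjI allI, rule c(1), rule impI, goal_cases)
    case (1 u0 u T t f)
    then have "in_Lp 2 (u t)" "Lp_norm 2 (u t) \<le> Lp_norm 2 u0" "weak_deriv \<zeta> (u t) f"
      using leray_solution_Lp_norm_le[of u0 u t] by auto
    from c(2)[OF this] show ?case unfolding sparse_at_scale_def by blast
  qed
next
  case (2 \<zeta> lam \<delta>)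
  then obtain c :: "real \<Rightarrow> real" where c: "\<And>M. 0 < c M"
    "\<And>v \<omega> f M. in_Lp 2 v \<Longrightarrow> Lp_norm 2 v \<le> M \<Longrightarrow> weak_curl v \<omega> \<Longrightarrow> weak_deriv \<zeta> \<omega> f \<Longrightarrow>
      sparse_at_scale lam \<delta> (c M) (1 / (real (Suc (mi_order \<zeta>)) + 3 / 2)) f"
    by (rule weak_curl_deriv_sparse[where p=2 and \<zeta>=\<zeta>]) auto
  \<comment> \<open>The curl counts as one more derivative, and k + 1 + 3/2 = k + 5/2.\<close>
  have exponent: "2 / (2 * real (mi_order \<zeta>) + 5) = 1 / (real (mi_order \<zeta>) + 5 / 2)"
    "real (Suc (mi_order \<zeta>)) + 3 / 2 = real (mi_order \<zeta>) + 5 / 2"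
    by (simp_all add: divide_simps)
  show ?case
    unfolding Let_def exponent(1)
  proof (rule exI[of _ c], intro conjI allI, rule c(1), rule impI, goal_cases)
    case (1 u0 u T t \<omega> f)
    then have "in_Lp 2 (u t)" "Lp_norm 2 (u t) \<le> Lp_norm 2 u0" "weak_curl (u t) \<omega>" "weak_deriv \<zeta> \<omega> f"
      using leray_solution_Lp_norm_le[of u0 u t] by auto
    from c(2)[OF this] show ?case unfolding sparse_at_scale_def exponent(2) by blast
  qed
next
  case (3 \<zeta> lam \<delta> p)
  then have "0 < lam \<and> lam < 1 \<and> 1 / (1 + lam) < \<delta> \<and> \<delta> < 1" "1 \<le> p" by auto
  then obtain c :: "real \<Rightarrow> real" where c: "\<And>M. 0 < c M"
    "\<And>(v :: real^'d \<Rightarrow> real^'d) f M. in_Lp p v \<Longrightarrow> Lp_norm p v \<le> M \<Longrightarrow> weak_deriv \<zeta> v f \<Longrightarrow>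
      sparse_at_scale lam \<delta> (c M) (1 / (real (mi_order \<zeta>) + real CARD('d) / p)) f"
    by (rule weak_deriv_sparse[where \<zeta>=\<zeta>]) auto
  show ?case
    unfolding Let_def
  proof (rule exI[of _ c], intro conjI allI, rule c(1), rule impI, goal_cases)
    case (1 u0 u T t f)
    then obtain M where M: "\<And>s. s \<in> {0<..<T} \<Longrightarrow> in_Lp p (u s) \<and> Lp_norm p (u s) \<le> M"
      using ess_bounded_in_Lp_imp_bounded[of p T u] 3 by auto
    \<comment> \<open>A real supremum bounds the members of its set only if the set is bounded
      above, hence the bound at all times rather than almost all.\<close>
    then have "bdd_above ((\<lambda>s. Lp_norm p (u s)) ` {0<..<T})" by (intro bdd_aboveI2[of _ _ M]) auto
    then have "Lp_norm p (u t) \<le> (SUP s\<in>{0<..<T}. Lp_norm p (u s))"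
      using 1 by (intro cSUP_upper) auto
    with c(2)[OF _ this] M 1 show ?case unfolding sparse_at_scale_def by blast
  qed
qed

end
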